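(* Let $\mathcal{M}$ be an $n$-dimensional smooth complete Riemannian manifold, let $f\colon\mathcal{M}\to\mathbb{R}$, $h=(h_1,\dots,h_s)\colon\mathcal{M}\to\mathbb{R}^s$ and $g=(g_1,\dots,g_m)\colon\mathcal{M}\to\mathbb{R}^m$ be continuously differentiable, and let $\Omega=\{q\in\mathcal{M}: h(q)=0,\ g(q)\le 0\}$. Suppose that $p\in\Omega$ satisfies CRSC. If $p$ is an AKKT point of the problem of minimizing $f$ over $\Omega$, then $p$ is a KKT point of this problem.
   Context: $d$ is the Riemannian distance, $B_\epsilon(p)=\{q\in\mathcal{M}: d(p,q)<\epsilon\}$, and $\operatorname{grad}$ is the Riemannian gradient. For $p\in\Omega$, $\mathcal{A}(p)=\{j\in\{1,\dots,m\}: g_j(p)=0\}$. The Lagrangian is $L(q,\lambda,\mu)=f(q)+\sum_{i=1}^s\lambda_ih_i(q)+\sum_{j=1}^m\mu_jg_j(q)$, and $\operatorname{grad}L$ denotes its gradient with respect to $q$. KKT point: $p\in\Omega$ for which there is $(\lambda,\mu)\in\mathbb{R}^s\times\mathbb{R}^m_+$ with $\operatorname{grad}L(p,\lambda,\mu)=0$ and $\mu_j=0$ for all $j\notin\mathcal{A}(p)$. AKKT point: $p\in\Omega$ for which there are sequences $(p^k)\subset\mathcal{M}$, $(\lambda^k)\subset\mathbb{R}^s$, $(\mu^k)\subset\mathbb{R}^m_+$ such that $p^k\to p$, $\operatorname{grad}L(p^k,\lambda^k,\mu^k)\to0$ (that is, $\|\operatorname{grad}L(p^k,\lambda^k,\mu^k)\|\to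 0$), and $\mu_j^k=0$ for all $j\notin\mathcal{A}(p)$ and all sufficiently large $k$. CRSC (constant rank of the subspace component): let $\mathcal{L}(p)^\circ=\{v\in T_p\mathcal{M}: v=\sum_{i=1}^s\lambda_i\operatorname{grad}h_i(p)+\sum_{j\in\mathcal{A}(p)}\mu_j\operatorname{grad}g_j(p),\ \lambda_i\in\mathbb{R},\ \mu_j\ge0\}$ and $\mathcal{J}_-(p)=\{j\in\mathcal{A}(p): -\operatorname{grad}g_j(p)\in\mathcal{L}(p)^\circ\}$. The point $p$ satisfies CRSC if there is $\epsilon>0$ such that the rank of $\{\operatorname{grad}h_i(q): i=1,\dots,s\}\cup\{\operatorname{grad}g_j(q): j\in\mathcal{J}_-(p)\}\subset T_q\mathcal{M}$ is constant for all $q\in B_\epsilon(p)$. *)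

theory Defs
  imports "HOL-Analysis.Analysis" "HOL-Library.Function_Algebras"
begin

section \<open>Smooth manifolds\<close>

text \<open>\<open>C\<^sup>k\<close> maps on an open set \<open>S\<close> of a normed space, by recursion through the
  directional derivatives.\<close>

primrec Ck_on :: "nat \<Rightarrow> 'e::real_normed_vector set \<Rightarrow> ('e \<Rightarrow> 'f::real_normed_vector) \<Rightarrow> bool" where
  "Ck_on 0 S = (\<lambda>f. continuous_on S f)"
| "Ck_on (Suc k) S = (\<lambda>f. (\<forall>x\<in>S. f differentiable (at x)) \<and>
      (\<forall>v. Ck_on k S (\<lambda>x. frechet_derivative f (at x) v)))"

definition smooth_on :: "'e::real_normed_vector set \<Rightarrow> ('e \<Rightarrow> 'f::real_normed_vector) \<Rightarrow> bool" where
  "smooth_on S f \<longleftrightarrow> (\<forall>k. Ck_on k S f)"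

text \<open>The manifold is the whole type \<open>'a\<close>, with the topology of that type. A chart is a pair of
  its domain and its coordinate map; values of the coordinate map outside the domain are
  irrelevant.\<close>

type_synonym ('a, 'e) chart = "'a set \<times> ('a \<Rightarrow> 'e)"

definition inv_chart :: "('a, 'e) chart \<Rightarrow> 'e \<Rightarrow> 'a" where
  "inv_chart c = inv_into (fst c) (snd c)"

definition is_chart :: "('a::topological_space, 'e::euclidean_space) chart \<Rightarrow> bool" where
  "is_chart c \<longleftrightarrow> open (fst c) \<and> open (snd c ` fst c) \<and>
     homeomorphism (fst c) (snd c ` fst c) (snd c) (inv_chart c)"

definition smooth_atlas :: "('a::topological_space, 'e::euclidean_space) chart set \<Rightarrow> bool" where
  "smooth_atlas A \<longleftrightarrow> (\<forall>c\<in>A. is_chart c) \<and> (\<Union>c\<in>A. fst c) = UNIV \<and>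
     (\<forall>c\<in>A. \<forall>c'\<in>A. smooth_on (snd c ` (fst c \<inter> fst c')) (snd c' \<circ> inv_chart c))"

definition charts_at :: "('a, 'e) chart set \<Rightarrow> 'a \<Rightarrow> ('a, 'e) chart set" where
  "charts_at A q = {c \<in> A. q \<in> fst c}"

definition C1_manifold ::
  "('a::topological_space, 'e::euclidean_space) chart set \<Rightarrow> ('a \<Rightarrow> real) \<Rightarrow> bool" where
  "C1_manifold A f \<longleftrightarrow> (\<forall>c\<in>A. Ck_on 1 (snd c ` fst c) (f \<circ> inv_chart c))"

section \<open>Tangent vectors\<close>

instantiation "fun" :: (type, real_vector) real_vector
begin

definition scaleR_fun :: "real \<Rightarrow> ('a \<Rightarrow> 'b) \<Rightarrow> 'a \<Rightarrow> 'b" where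
  "scaleR_fun r f = (\<lambda>x. r *\<^sub>R f x)"

instance
  by standard (simp_all add: scaleR_fun_def plus_fun_def fun_eq_iff scaleR_add_left scaleR_add_right)

end

text \<open>A tangent vector at \<open>q\<close> is the family of its coordinates in the charts around \<open>q\<close>, which
  transform by the derivatives of the transition maps. The family is \<open>0\<close> at the other charts, so
  that a tangent vector at \<open>q\<close> is determined by its coordinates in any one chart around \<open>q\<close>.
  Linear operations are pointwise.\<close>

type_synonym ('a, 'e) tangent = "('a, 'e) chart \<Rightarrow> 'e"

definition tangent_space ::
  "('a, 'e::euclidean_space) chart set \<Rightarrow> 'a \<Rightarrow> ('a, 'e) tangent set" where
  "tangent_space A q = {v.
     (\<forall>c. c \<notin> charts_at A q \<longrightarrow> v c = 0) \<and>
     (\<forall>c\<in>charts_at A q. \<forall>c'\<in>charts_at A q.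
        v c' = frechet_derivative (snd c' \<circ> inv_chart c) (at (snd c q)) (v c))}"

text \<open>The tangent vector at \<open>q\<close> with coordinates \<open>u\<close> in the chart \<open>c\<close> around \<open>q\<close>.\<close>

definition coord_vector ::
  "('a, 'e::euclidean_space) chart set \<Rightarrow> ('a, 'e) chart \<Rightarrow> 'a \<Rightarrow> 'e \<Rightarrow> ('a, 'e) tangent" where
  "coord_vector A c q u = (\<lambda>c'. if c' \<in> charts_at A q
     then frechet_derivative (snd c' \<circ> inv_chart c) (at (snd c q)) u else 0)"

text \<open>The value does not depend on the chart that is chosen, by the chain rule.\<close>

definition differential ::
  "('a, 'e::euclidean_space) chart set \<Rightarrow> ('a \<Rightarrow> real) \<Rightarrow> 'a \<Rightarrow> ('a, 'e) tangent \<Rightarrow> real" where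
  "differential A f q v = (let c = (SOME c. c \<in> charts_at A q) in
     frechet_derivative (f \<circ> inv_chart c) (at (snd c q)) (v c))"

section \<open>Riemannian metrics\<close>

type_synonym ('a, 'e) metric = "'a \<Rightarrow> ('a, 'e) tangent \<Rightarrow> ('a, 'e) tangent \<Rightarrow> real"

definition riemannian_metric ::
  "('a::topological_space, 'e::euclidean_space) chart set \<Rightarrow> ('a, 'e) metric \<Rightarrow> bool" where
  "riemannian_metric A G \<longleftrightarrow>
     (\<forall>q. \<forall>u\<in>tangent_space A q. \<forall>v\<in>tangent_space A q. G q u v = G q v u) \<and>
     (\<forall>q. \<forall>u\<in>tangent_space A q. \<forall>v\<in>tangent_space A q. \<forall>w\<in>tangent_space A q. \<forall>a b.
        G q (a *\<^sub>R u + b *\<^sub>R v) w = a * G q u w + b * G q v w) \<and>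
     (\<forall>q. \<forall>v\<in>tangent_space A q. v \<noteq> 0 \<longrightarrow> G q v v > 0) \<and>
     (\<forall>c\<in>A. \<forall>u v. smooth_on (snd c ` fst c) (\<lambda>x. G (inv_chart c x)
        (coord_vector A c (inv_chart c x) u) (coord_vector A c (inv_chart c x) v)))"

definition riemannian_manifold ::
  "('a::topological_space, 'e::euclidean_space) chart set \<Rightarrow> ('a, 'e) metric \<Rightarrow> bool" where
  "riemannian_manifold A G \<longleftrightarrow> smooth_atlas A \<and> riemannian_metric A G"

definition tangent_norm :: "('a, 'e) metric \<Rightarrow> 'a \<Rightarrow> ('a, 'e) tangent \<Rightarrow> real" where
  "tangent_norm G q v = sqrt (G q v v)"

definition grad ::
  "('a, 'e::euclidean_space) chart set \<Rightarrow> ('a, 'e) metric \<Rightarrow> ('a \<Rightarrow> real) \<Rightarrow> 'a \<Rightarrow> ('a, 'e) tangent" where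
  "grad A G f q = (THE w. w \<in> tangent_space A q \<and>
     (\<forall>v\<in>tangent_space A q. G q w v = differential A f q v))"

section \<open>Riemannian distance and completeness\<close>

definition C1_curve ::
  "('a::topological_space, 'e::euclidean_space) chart set \<Rightarrow> (real \<Rightarrow> 'a) \<Rightarrow> real \<Rightarrow> real \<Rightarrow> bool" where
  "C1_curve A \<gamma> a b \<longleftrightarrow> continuous_on {a..b} \<gamma> \<and>
     (\<forall>c\<in>A. (\<forall>t\<in>{t\<in>{a..b}. \<gamma> t \<in> fst c}. (snd c \<circ> \<gamma>) differentiable (at t within {a..b})) \<and>
        continuous_on {t\<in>{a..b}. \<gamma> t \<in> fst c}
          (\<lambda>t. vector_derivative (snd c \<circ> \<gamma>) (at t within {a..b})))"

definition velocity ::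
  "('a, 'e::euclidean_space) chart set \<Rightarrow> (real \<Rightarrow> 'a) \<Rightarrow> real \<Rightarrow> real \<Rightarrow> real \<Rightarrow> ('a, 'e) tangent" where
  "velocity A \<gamma> a b t = (\<lambda>c. if c \<in> charts_at A (\<gamma> t)
     then vector_derivative (snd c \<circ> \<gamma>) (at t within {a..b}) else 0)"

definition curve_length ::
  "('a, 'e::euclidean_space) chart set \<Rightarrow> ('a, 'e) metric \<Rightarrow> (real \<Rightarrow> 'a) \<Rightarrow> real \<Rightarrow> real \<Rightarrow> real" where
  "curve_length A G \<gamma> a b = integral {a..b} (\<lambda>t. tangent_norm G (\<gamma> t) (velocity A \<gamma> a b t))"

text \<open>Infimum of the lengths of the piecewise \<open>C\<^sup>1\<close> curves from \<open>p\<close> to \<open>q\<close>; \<open>\<tau> 0 < \<dots> < \<tau> N\<close> is the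
  partition. The manifold need not be connected: points in different components have
  distance \<open>\<infinity>\<close>.\<close>

definition riemannian_dist ::
  "('a::topological_space, 'e::euclidean_space) chart set \<Rightarrow> ('a, 'e) metric \<Rightarrow> 'a \<Rightarrow> 'a \<Rightarrow> ennreal" where
  "riemannian_dist A G p q = Inf {ennreal (\<Sum>i<N. curve_length A G \<gamma> (\<tau> i) (\<tau> (Suc i))) | \<gamma> \<tau> N.
     (\<forall>i<N. \<tau> i < \<tau> (Suc i) \<and> C1_curve A \<gamma> (\<tau> i) (\<tau> (Suc i))) \<and>
     \<gamma> (\<tau> 0) = p \<and> \<gamma> (\<tau> N) = q}"

definition riemannian_ball ::
  "('a::topological_space, 'e::euclidean_space) chart set \<Rightarrow> ('a, 'e) metric \<Rightarrow> real \<Rightarrow> 'a \<Rightarrow> 'a set" where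
  "riemannian_ball A G \<epsilon> p = {q. riemannian_dist A G p q < ennreal \<epsilon>}"

definition complete_riemannian_manifold ::
  "('a::topological_space, 'e::euclidean_space) chart set \<Rightarrow> ('a, 'e) metric \<Rightarrow> bool" where
  "complete_riemannian_manifold A G \<longleftrightarrow> riemannian_manifold A G \<and>
     (\<forall>X. (\<forall>\<epsilon>>0. \<exists>N. \<forall>i\<ge>N. \<forall>j\<ge>N. riemannian_dist A G (X i) (X j) < ennreal \<epsilon>) \<longrightarrow>
        (\<exists>x. (\<lambda>i. riemannian_dist A G (X i) x) \<longlonglongrightarrow> 0))"

section \<open>The constrained problem\<close>

text \<open>Of the families \<open>h\<close> and \<open>g\<close> of constraint functions and of the multipliers, only the
  members with index in \<open>{1..s}\<close> and \<open>{1..m}\<close>, respectively, are used.\<close>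

definition feasible_set ::
  "nat \<Rightarrow> nat \<Rightarrow> (nat \<Rightarrow> 'a \<Rightarrow> real) \<Rightarrow> (nat \<Rightarrow> 'a \<Rightarrow> real) \<Rightarrow> 'a set" where
  "feasible_set s m h g = {q. (\<forall>i\<in>{1..s}. h i q = 0) \<and> (\<forall>j\<in>{1..m}. g j q \<le> 0)}"

definition active_set :: "nat \<Rightarrow> (nat \<Rightarrow> 'a \<Rightarrow> real) \<Rightarrow> 'a \<Rightarrow> nat set" where
  "active_set m g p = {j\<in>{1..m}. g j p = 0}"

definition lagrangian ::
  "nat \<Rightarrow> nat \<Rightarrow> ('a \<Rightarrow> real) \<Rightarrow> (nat \<Rightarrow> 'a \<Rightarrow> real) \<Rightarrow> (nat \<Rightarrow> 'a \<Rightarrow> real) \<Rightarrow>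
    (nat \<Rightarrow> real) \<Rightarrow> (nat \<Rightarrow> real) \<Rightarrow> 'a \<Rightarrow> real" where
  "lagrangian s m f h g lam \<mu> q = f q + (\<Sum>i=1..s. lam i * h i q) + (\<Sum>j=1..m. \<mu> j * g j q)"

definition KKT_point ::
  "('a, 'e::euclidean_space) chart set \<Rightarrow> ('a, 'e) metric \<Rightarrow> nat \<Rightarrow> nat \<Rightarrow> ('a \<Rightarrow> real) \<Rightarrow>
    (nat \<Rightarrow> 'a \<Rightarrow> real) \<Rightarrow> (nat \<Rightarrow> 'a \<Rightarrow> real) \<Rightarrow> 'a \<Rightarrow> bool" where
  "KKT_point A G s m f h g p \<longleftrightarrow> p \<in> feasible_set s m h g \<and>
     (\<exists>lam \<mu>. (\<forall>j\<in>{1..m}. \<mu> j \<ge> 0) \<and>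
        grad A G (lagrangian s m f h g lam \<mu>) p = 0 \<and>
        (\<forall>j\<in>{1..m} - active_set m g p. \<mu> j = 0))"

definition AKKT_point ::
  "('a::topological_space, 'e::euclidean_space) chart set \<Rightarrow> ('a, 'e) metric \<Rightarrow> nat \<Rightarrow> nat \<Rightarrow>
    ('a \<Rightarrow> real) \<Rightarrow> (nat \<Rightarrow> 'a \<Rightarrow> real) \<Rightarrow> (nat \<Rightarrow> 'a \<Rightarrow> real) \<Rightarrow> 'a \<Rightarrow> bool" where
  "AKKT_point A G s m f h g p \<longleftrightarrow> p \<in> feasible_set s m h g \<and>
     (\<exists>P lam \<mu>. (\<forall>k. \<forall>j\<in>{1..m}. \<mu> k j \<ge> 0) \<and>
        P \<longlonglongrightarrow> p \<and>
        (\<lambda>k::nat. tangent_norm G (P k) (grad A G (lagrangian s m f h g (lam k) (\<mu> k)) (P k)))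
          \<longlonglongrightarrow> 0 \<and>
        (\<forall>\<^sub>F k in sequentially. \<forall>j\<in>{1..m} - active_set m g p. \<mu> k j = 0))"

definition polar_linearized_cone ::
  "('a, 'e::euclidean_space) chart set \<Rightarrow> ('a, 'e) metric \<Rightarrow> nat \<Rightarrow> nat \<Rightarrow>
    (nat \<Rightarrow> 'a \<Rightarrow> real) \<Rightarrow> (nat \<Rightarrow> 'a \<Rightarrow> real) \<Rightarrow> 'a \<Rightarrow> ('a, 'e) tangent set" where
  "polar_linearized_cone A G s m h g p =
     {v \<in> tangent_space A p. \<exists>lam \<mu>. (\<forall>j\<in>active_set m g p. \<mu> j \<ge> 0) \<and>
        v = (\<Sum>i=1..s. lam i *\<^sub>R grad A G (h i) p) +
            (\<Sum>j\<in>active_set m g p. \<mu> j *\<^sub>R grad A G (g j) p)}"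

definition J_minus ::
  "('a, 'e::euclidean_space) chart set \<Rightarrow> ('a, 'e) metric \<Rightarrow> nat \<Rightarrow> nat \<Rightarrow>
    (nat \<Rightarrow> 'a \<Rightarrow> real) \<Rightarrow> (nat \<Rightarrow> 'a \<Rightarrow> real) \<Rightarrow> 'a \<Rightarrow> nat set" where
  "J_minus A G s m h g p =
     {j \<in> active_set m g p. - grad A G (g j) p \<in> polar_linearized_cone A G s m h g p}"

text \<open>The rank of a set of tangent vectors is the dimension of its linear span.\<close>

definition CRSC ::
  "('a::topological_space, 'e::euclidean_space) chart set \<Rightarrow> ('a, 'e) metric \<Rightarrow> nat \<Rightarrow> nat \<Rightarrow>
    (nat \<Rightarrow> 'a \<Rightarrow> real) \<Rightarrow> (nat \<Rightarrow> 'a \<Rightarrow> real) \<Rightarrow> 'a \<Rightarrow> bool" where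
  "CRSC A G s m h g p \<longleftrightarrow> (\<exists>\<epsilon>>0. \<exists>r. \<forall>q\<in>riemannian_ball A G \<epsilon> p.
     dim ({grad A G (h i) q | i. i \<in> {1..s}} \<union>
          {grad A G (g j) q | j. j \<in> J_minus A G s m h g p}) = r)"

end

theory Submission
  imports Defs
begin

text \<open>Everything is local, so it suffices to work in one chart around \<open>p\<close>. There each function has a
coordinate gradient, the vector of its partial derivatives. At every point the Riemannian gradient
is the image of the coordinate gradient under an injective linear map that depends only on the
point (\<open>grad_musical_isomorphism\<close>). Hence stationarity, membership in the polar cone and the ranks
in CRSC can all be read off from coordinate gradients, which depend continuously on the point. Two
facts link the Riemannian hypotheses to coordinates: small Riemannian gradient norms force small
coordinate gradients, by Cauchy--Schwarz and continuity of the metric (\<open>chart_gradient_tendsto_0\<close>);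
and a Riemannian ball contains a neighbourhood of its centre, because straight segments in the
chart have length at most a constant times their Euclidean length
(\<open>riemannian_ball_neighborhood\<close>).

What remains is a statement about vectors in a Euclidean space, \<open>constant_rank_limit_multipliers\<close>.
A combination of the gradients tends to minus the gradient of the objective; the only obstacle to
passing to the limit is that the multipliers may be unbounded. Take
a basis, at \<open>p\<close>, of the span of the equality gradients and the gradients in \<open>\<J>\<^sub>-(p)\<close>. Since the
rank is constant, the same indices give a basis of the corresponding span at nearby points, so
these multipliers can be replaced by multipliers of the basis without changing the sum; the
multipliers of the other active inequalities keep their signs. The reduced family at \<open>p\<close> is
positively linearly independent: a vanishing combination, with nonnegative coefficients outside
\<open>\<J>\<^sub>-(p)\<close>, in which some \<open>g\<^sub>j\<close> outside \<open>\<J>\<^sub>-(p)\<close> has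
a positive coefficient would exhibit \<open>-grad g\<^sub>j\<close> as an element of the polar cone, that is,
\<open>j \<in> \<J>\<^sub>-(p)\<close>; a combination of the basis alone vanishes only trivially. Positive linear
independence is stable under perturbation with a uniform lower bound
(\<open>positive_independence_stable\<close>), so the new multipliers are bounded and a subsequence converges.
The limit lies in the polar cone, because that cone contains the span of the basis.\<close>

section \<open>Stability of positive linear independence\<close>

lemma bounded_family_convergent_subsequence:
  fixes x :: "nat \<Rightarrow> 'i \<Rightarrow> real"
  assumes "finite I" and "\<And>k i. i \<in> I \<Longrightarrow> \<bar>x k i\<bar> \<le> C"
  shows "\<exists>l r. strict_mono (r :: nat \<Rightarrow> nat) \<and> (\<forall>i\<in>I. (\<lambda>k. x (r k) i) \<longlonglongrightarrow> l i)"
  using assms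
proof (induction I rule: finite_induct)
  case empty
  show ?case using strict_mono_id by auto
next
  case (insert a I)
  then obtain l r where r: "strict_mono (r :: nat \<Rightarrow> nat)"
    and l: "\<forall>i\<in>I. (\<lambda>k. x (r k) i) \<longlonglongrightarrow> l i"
    by auto
  have "bounded (range (\<lambda>k. x (r k) a))"
    using insert.prems by (auto simp: bounded_iff)
  then obtain b r' where r': "strict_mono (r' :: nat \<Rightarrow> nat)"
    and b: "((\<lambda>k. x (r k) a) \<circ> r') \<longlonglongrightarrow> b"
    using bounded_imp_convergent_subsequence by blast
  have "(\<lambda>k. x ((r \<circ> r') k) i) \<longlonglongrightarrow> (l(a := b)) i" if "i \<in> insert a I" for i
  proof (cases "i = a")
    case True
    then show ?thesis using b by (simp add: o_def)
  next
    case False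
    then have "(\<lambda>k. x (r k) i) \<longlonglongrightarrow> l i" using that l by auto
    from LIMSEQ_subseq_LIMSEQ[OF this r'] show ?thesis using False by (simp add: o_def)
  qed
  then show ?case using strict_mono_o[OF r r'] by blast
qed

text \<open>On the compact set of coefficient vectors with \<open>\<ell>\<^sup>1\<close>-norm 1 that are nonnegative on \<open>J\<close>, the norm
of the combination is continuous and, by hypothesis, nowhere zero; so it has a positive lower bound
\<open>d\<close>. Moving each vector by at most \<open>d / 2\<close> changes such a combination by at most \<open>d / 2\<close>.\<close>
lemma positive_independence_stable:
  fixes v :: "'i \<Rightarrow> 'e::real_normed_vector"
  assumes I: "finite I" and J: "J \<subseteq> I"
    and indep: "\<And>x. \<lbrakk>\<And>j. j \<in> J \<Longrightarrow> x j \<ge> 0; (\<Sum>i\<in>I. x i *\<^sub>R v i) = 0\<rbrakk> \<Longrightarrow> \<forall>i\<in>I. x i = 0"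
  obtains \<delta> where "\<delta> > 0"
    and "\<And>w x. \<lbrakk>\<And>i. i \<in> I \<Longrightarrow> norm (w i - v i) \<le> \<delta>; \<And>j. j \<in> J \<Longrightarrow> x j \<ge> 0\<rbrakk> \<Longrightarrow>
           \<delta> * (\<Sum>i\<in>I. \<bar>x i\<bar>) \<le> norm (\<Sum>i\<in>I. x i *\<^sub>R w i)"
proof -
  have "\<exists>d>0. \<forall>x. (\<forall>j\<in>J. x j \<ge> 0) \<longrightarrow> d * (\<Sum>i\<in>I. \<bar>x i\<bar>) \<le> norm (\<Sum>i\<in>I. x i *\<^sub>R v i)"
  proof (rule ccontr)
    assume "\<not> ?thesis"
    then have "\<forall>k. \<exists>x. (\<forall>j\<in>J. x j \<ge> 0) \<and>
        norm (\<Sum>i\<in>I. x i *\<^sub>R v i) < inverse (real (Suc k)) * (\<Sum>i\<in>I. \<bar>x i\<bar>)"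
      by (meson not_le inverse_Suc)
    then obtain x where x0: "\<And>k j. j \<in> J \<Longrightarrow> x k j \<ge> 0"
      and x: "\<And>k. norm (\<Sum>i\<in>I. x k i *\<^sub>R v i) < inverse (real (Suc k)) * (\<Sum>i\<in>I. \<bar>x k i\<bar>)"
      by metis
    define S where "S k = (\<Sum>i\<in>I. \<bar>x k i\<bar>)" for k
    have S: "S k > 0" for k
    proof -
      have "0 < inverse (real (Suc k)) * S k"
        unfolding S_def by (rule le_less_trans[OF norm_ge_zero x])
      then show ?thesis by (simp add: zero_less_mult_iff)
    qed
    define y where "y k i = x k i / S k" for k i
    have y_sum: "(\<Sum>i\<in>I. \<bar>y k i\<bar>) = 1" for k
      using S[of k] unfolding y_def
      by (simp add: abs_divide sum_divide_distrib[symmetric] S_def[symmetric])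
    have y0: "y k j \<ge> 0" if "j \<in> J" for k j
      using x0[OF that] S[of k] by (simp add: y_def)
    have y_small: "norm (\<Sum>i\<in>I. y k i *\<^sub>R v i) \<le> inverse (real (Suc k))" for k
    proof -
      have "(\<Sum>i\<in>I. y k i *\<^sub>R v i) = inverse (S k) *\<^sub>R (\<Sum>i\<in>I. x k i *\<^sub>R v i)"
        by (simp add: y_def scaleR_sum_right divide_inverse mult.commute)
      then have "norm (\<Sum>i\<in>I. y k i *\<^sub>R v i) = inverse (S k) * norm (\<Sum>i\<in>I. x k i *\<^sub>R v i)"
        using S[of k] by simp
      also have "\<dots> \<le> inverse (S k) * (inverse (real (Suc k)) * S k)"
        using x[of k] S[of k] unfolding S_def[symmetric] by (intro mult_left_mono) auto
      also have "\<dots> = inverse (real (Suc k))"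
        using S[of k] by (simp add: field_simps del: of_nat_Suc)
      finally show ?thesis .
    qed
    have y_le: "\<bar>y k i\<bar> \<le> 1" if "i \<in> I" for k i
      using member_le_sum[OF that, of "\<lambda>i. \<bar>y k i\<bar>"] I y_sum[of k] by simp
    obtain l r where r: "strict_mono r" and l: "\<And>i. i \<in> I \<Longrightarrow> (\<lambda>k. y (r k) i) \<longlonglongrightarrow> l i"
      using bounded_family_convergent_subsequence[where x = y, OF I y_le] by blast
    have "(\<lambda>k. \<Sum>i\<in>I. y (r k) i *\<^sub>R v i) \<longlonglongrightarrow> (\<Sum>i\<in>I. l i *\<^sub>R v i)"
      by (intro tendsto_intros l)
    moreover have "(\<lambda>k. \<Sum>i\<in>I. y k i *\<^sub>R v i) \<longlonglongrightarrow> 0"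
      by (rule Lim_null_comparison[OF _ LIMSEQ_inverse_real_of_nat]) (simp add: y_small del: of_nat_Suc)
    from LIMSEQ_subseq_LIMSEQ[OF this r]
    have "(\<lambda>k. \<Sum>i\<in>I. y (r k) i *\<^sub>R v i) \<longlonglongrightarrow> 0" by (simp add: o_def)
    ultimately have "(\<Sum>i\<in>I. l i *\<^sub>R v i) = 0" by (rule LIMSEQ_unique)
    moreover have "l j \<ge> 0" if "j \<in> J" for j
      using that J y0 by (intro LIMSEQ_le_const[OF l]) auto
    ultimately have "\<forall>i\<in>I. l i = 0" by (intro indep)
    moreover have "(\<lambda>k. \<Sum>i\<in>I. \<bar>y (r k) i\<bar>) \<longlonglongrightarrow> (\<Sum>i\<in>I. \<bar>l i\<bar>)"
      by (intro tendsto_intros l)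
    ultimately show False
      by (simp add: y_sum LIMSEQ_const_iff)
  qed
  then obtain d where d: "d > 0"
    and low: "\<And>x. \<forall>j\<in>J. x j \<ge> 0 \<Longrightarrow> d * (\<Sum>i\<in>I. \<bar>x i\<bar>) \<le> norm (\<Sum>i\<in>I. x i *\<^sub>R v i)"
    by blast
  show thesis
  proof
    show "d / 2 > 0" using d by simp
    fix w :: "'i \<Rightarrow> 'e" and x :: "'i \<Rightarrow> real"
    assume w: "\<And>i. i \<in> I \<Longrightarrow> norm (w i - v i) \<le> d / 2" and x: "\<And>j. j \<in> J \<Longrightarrow> x j \<ge> 0"
    have "norm ((\<Sum>i\<in>I. x i *\<^sub>R v i) - (\<Sum>i\<in>I. x i *\<^sub>R w i))
        = norm (\<Sum>i\<in>I. x i *\<^sub>R (v i - w i))"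
      by (simp add: sum_subtractf algebra_simps)
    also have "\<dots> \<le> (\<Sum>i\<in>I. \<bar>x i\<bar> * (d / 2))"
    proof (rule sum_norm_le)
      fix i assume "i \<in> I"
      then have "norm (v i - w i) \<le> d / 2" using w by (metis norm_minus_commute)
      then show "norm (x i *\<^sub>R (v i - w i)) \<le> \<bar>x i\<bar> * (d / 2)"
        unfolding norm_scaleR by (rule mult_left_mono) simp
    qed
    also have "\<dots> = d / 2 * (\<Sum>i\<in>I. \<bar>x i\<bar>)"
      by (simp add: sum_distrib_left mult.commute)
    finally have "norm (\<Sum>i\<in>I. x i *\<^sub>R v i) \<le>
        norm (\<Sum>i\<in>I. x i *\<^sub>R w i) + d / 2 * (\<Sum>i\<in>I. \<bar>x i\<bar>)"
      using norm_triangle_sub[of "\<Sum>i\<in>I. x i *\<^sub>R v i" "\<Sum>i\<in>I. x i *\<^sub>R w i"] by linarith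
    moreover have "d * (\<Sum>i\<in>I. \<bar>x i\<bar>) \<le> norm (\<Sum>i\<in>I. x i *\<^sub>R v i)"
      using low x by blast
    ultimately show "d / 2 * (\<Sum>i\<in>I. \<bar>x i\<bar>) \<le> norm (\<Sum>i\<in>I. x i *\<^sub>R w i)"
      by (simp add: field_simps)
  qed
qed

section \<open>Multipliers along a sequence of constant rank\<close>

text \<open>Independence of a set forgets repetitions: two equal vectors of a family count once. Together with
injectivity of the enumeration it becomes the usual condition on coefficients, which is the form
that survives perturbation.\<close>
lemma independent_family_iff:
  fixes f :: "'i \<Rightarrow> 'e::euclidean_space"
  assumes "finite B"
  shows "inj_on f B \<and> independent (f ` B) \<longleftrightarrow>
    (\<forall>x. (\<Sum>b\<in>B. x b *\<^sub>R f b) = 0 \<longrightarrow> (\<forall>b\<in>B. x b = 0))" (is "?L \<longleftrightarrow> ?R")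
proof
  assume L: ?L
  show ?R
  proof (intro allI impI ballI)
    fix x b assume x: "(\<Sum>b\<in>B. x b *\<^sub>R f b) = 0" and b: "b \<in> B"
    have "(\<Sum>u\<in>f ` B. x (the_inv_into B f u) *\<^sub>R u) = (\<Sum>b\<in>B. x b *\<^sub>R f b)"
      using L by (subst sum.reindex) (auto simp: the_inv_into_f_f intro!: sum.cong)
    then have "x (the_inv_into B f (f b)) = 0"
      using L x b independent_explicit[of "f ` B"] by auto
    then show "x b = 0" using L b by (simp add: the_inv_into_f_f)
  qed
next
  assume R: ?R
  have inj: "inj_on f B"
  proof (rule inj_onI, rule ccontr)
    fix b b' assume b: "b \<in> B" "b' \<in> B" "f b = f b'" "b \<noteq> b'"
    define x where "x i = (if i = b then 1 else if i = b' then - 1 else 0 :: real)" for i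
    have "(\<Sum>i\<in>B. x i *\<^sub>R f i) = (\<Sum>i\<in>{b, b'}. x i *\<^sub>R f i)"
      using assms b by (intro sum.mono_neutral_right) (auto simp: x_def)
    also have "\<dots> = 0" using b by (simp add: x_def)
    finally have "x b = 0" using R b by blast
    then show False by (simp add: x_def)
  qed
  have "independent (f ` B)"
    unfolding independent_explicit
  proof (intro conjI allI impI ballI)
    show "finite (f ` B)" using assms by simp
    fix c u assume c: "(\<Sum>u\<in>f ` B. c u *\<^sub>R u) = 0" and u: "u \<in> f ` B"
    have "(\<Sum>b\<in>B. c (f b) *\<^sub>R f b) = 0" using c inj by (simp add: sum.reindex)
    then show "c u = 0" using R u by (auto dest!: spec[of _ "c \<circ> f"])
  qed
  with inj show ?L by blast
qed

lemma span_image_finite: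
  fixes f :: "'i \<Rightarrow> 'e::real_vector"
  assumes "finite B" and "u \<in> span (f ` B)"
  shows "\<exists>x. u = (\<Sum>b\<in>B. x b *\<^sub>R f b)"
proof -
  from assms(2) show ?thesis
  proof (induction rule: span_induct_alt)
    case base
    show ?case by (rule exI[of _ "\<lambda>_. 0"]) simp
  next
    case (step c u w)
    then obtain b x where b: "b \<in> B" "u = f b" and x: "w = (\<Sum>b\<in>B. x b *\<^sub>R f b)" by auto
    have "c *\<^sub>R u = (\<Sum>i\<in>B. (if i = b then c else 0) *\<^sub>R f i)"
      using b assms(1) by (simp add: if_distrib[of "\<lambda>t. t *\<^sub>R _"] cong: if_cong)
    then have "c *\<^sub>R u + w = (\<Sum>i\<in>B. ((if i = b then c else 0) + x i) *\<^sub>R f i)"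
      by (simp add: x scaleR_add_left sum.distrib)
    then show ?case by (rule exI[of _ "\<lambda>i. (if i = b then c else 0) + x i"])
  qed
qed

text \<open>Coordinate version of the polar of the linearized cone: \<open>E\<close> indexes the equality constraints,
whose multipliers are free, and \<open>F\<close> the active inequality constraints.\<close>
definition multiplier_cone :: "'i set \<Rightarrow> 'i set \<Rightarrow> ('i \<Rightarrow> 'e::real_vector) \<Rightarrow> 'e set" where
  "multiplier_cone E F v = {\<Sum>i\<in>E \<union> F. x i *\<^sub>R v i | x. \<forall>j\<in>F. x j \<ge> (0::real)}"

lemma multiplier_cone_add:
  assumes "u \<in> multiplier_cone E F v" "w \<in> multiplier_cone E F v"
  shows "u + w \<in> multiplier_cone E F v"
proof -
  from assms obtain x y where xy: "\<forall>j\<in>F. x j \<ge> (0::real)" "\<forall>j\<in>F. y j \<ge> (0::real)"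
    "u = (\<Sum>i\<in>E \<union> F. x i *\<^sub>R v i)" "w = (\<Sum>i\<in>E \<union> F. y i *\<^sub>R v i)"
    by (auto simp: multiplier_cone_def)
  have "u + w = (\<Sum>i\<in>E \<union> F. (x i + y i) *\<^sub>R v i)"
    by (simp add: xy scaleR_add_left sum.distrib)
  moreover have "\<forall>j\<in>F. x j + y j \<ge> 0" using xy by auto
  ultimately show ?thesis by (auto simp: multiplier_cone_def)
qed

lemma multiplier_cone_scale:
  assumes "u \<in> multiplier_cone E F v" "t \<ge> 0"
  shows "t *\<^sub>R u \<in> multiplier_cone E F v"
proof -
  from assms obtain x where x: "\<forall>j\<in>F. x j \<ge> (0::real)" "u = (\<Sum>i\<in>E \<union> F. x i *\<^sub>R v i)"
    by (auto simp: multiplier_cone_def)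
  have "t *\<^sub>R u = (\<Sum>i\<in>E \<union> F. (t * x i) *\<^sub>R v i)"
    by (simp add: x scaleR_sum_right)
  moreover have "\<forall>j\<in>F. t * x j \<ge> 0" using x assms by auto
  ultimately show ?thesis by (auto simp: multiplier_cone_def)
qed

lemma zero_in_multiplier_cone: "0 \<in> multiplier_cone E F v"
  unfolding multiplier_cone_def by (rule CollectI, rule exI[of _ "\<lambda>_. 0"]) simp

lemma multiplier_cone_generator:
  assumes "finite E" "finite F" "i \<in> E \<union> F" "i \<in> F \<Longrightarrow> t \<ge> 0"
  shows "t *\<^sub>R v i \<in> multiplier_cone E F v"
proof -
  have "t *\<^sub>R v i = (\<Sum>k\<in>E \<union> F. (if k = i then t else 0) *\<^sub>R v k)"
    using assms by (simp add: if_distrib[of "\<lambda>t. t *\<^sub>R _"] cong: if_cong)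
  moreover have "\<forall>j\<in>F. (if j = i then t else 0) \<ge> 0" using assms by auto
  ultimately show ?thesis
    unfolding multiplier_cone_def
    by (intro CollectI exI[of _ "\<lambda>k. if k = i then t else 0"] conjI)
qed

lemma multiplier_cone_sum:
  assumes "\<And>i. i \<in> I \<Longrightarrow> u i \<in> multiplier_cone E F v"
  shows "(\<Sum>i\<in>I. u i) \<in> multiplier_cone E F v"
  using assms
  by (induction I rule: infinite_finite_induct)
     (auto intro: multiplier_cone_add zero_in_multiplier_cone)

text \<open>Coordinate version of \<open>\<J>\<^sub>-(p)\<close>: these generators of the cone may be reversed within it.\<close>
definition reversible_indices :: "'i set \<Rightarrow> 'i set \<Rightarrow> ('i \<Rightarrow> 'e::real_vector) \<Rightarrow> 'i set" where
  "reversible_indices E F v = {j \<in> F. - v j \<in> multiplier_cone E F v}"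

text \<open>A generator with index in \<open>E\<close> or in this set may be used with either sign without leaving the cone:
in \<open>E\<close> because multipliers there are free, otherwise because its negative is in the cone by
definition. So every linear combination of these generators is available.\<close>
lemma span_reversible_indices_subset_multiplier_cone:
  assumes "finite E" "finite F" "E \<inter> F = {}"
  shows "span (v ` (E \<union> reversible_indices E F v)) \<subseteq> multiplier_cone E F v"
proof
  fix u assume "u \<in> span (v ` (E \<union> reversible_indices E F v))"
  then show "u \<in> multiplier_cone E F v"
  proof (induction rule: span_induct_alt)
    case base
    show ?case by (rule zero_in_multiplier_cone)
  next
    case (step c u w)
    then obtain i where i: "i \<in> E \<union> reversible_indices E F v" "u = v i" by auto
    have "c *\<^sub>R v i \<in> multiplier_cone E F v"
    proof (cases "i \<in> E \<or> c \<ge> 0")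
      case True
      then show ?thesis using i assms
        by (intro multiplier_cone_generator) (auto simp: reversible_indices_def)
    next
      case False
      then have "- v i \<in> multiplier_cone E F v" using i by (auto simp: reversible_indices_def)
      from multiplier_cone_scale[OF this, of "- c"] False show ?thesis by simp
    qed
    then show ?case using i step.IH by (auto intro: multiplier_cone_add)
  qed
qed

text \<open>The Euclidean core of the theorem. The coefficients \<open>x k\<close> may be unbounded; constancy of the
rank allows exchanging them for bounded ones with the same combination. Here \<open>c\<close> plays the role of
the gradient of the objective along the sequence.\<close>
lemma constant_rank_limit_multipliers:
  fixes v :: "nat \<Rightarrow> 'i \<Rightarrow> 'e::euclidean_space"
  assumes E: "finite E" and F: "finite F" and EF: "E \<inter> F = {}"
    and v: "\<And>i. i \<in> E \<union> F \<Longrightarrow> (\<lambda>k. v k i) \<longlonglongrightarrow> v0 i"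
    and c: "c \<longlonglongrightarrow> c0"
    and x: "\<And>k j. j \<in> F \<Longrightarrow> x k j \<ge> 0"
    and stat: "(\<lambda>k. c k + (\<Sum>i\<in>E \<union> F. x k i *\<^sub>R v k i)) \<longlonglongrightarrow> 0"
    and rank: "\<forall>\<^sub>F k in sequentially.
      dim (v k ` (E \<union> reversible_indices E F v0)) = dim (v0 ` (E \<union> reversible_indices E F v0))"
  shows "- c0 \<in> multiplier_cone E F v0"
proof -
  define N where "N = reversible_indices E F v0"
  have N: "N \<subseteq> F" by (auto simp: N_def reversible_indices_def)
  define K where "K = multiplier_cone E F v0"
  have K_span: "span (v0 ` (E \<union> N)) \<subseteq> K"
    unfolding N_def K_def using span_reversible_indices_subset_multiplier_cone[OF E F EF] .
  have K_gen: "t *\<^sub>R v0 i \<in> K" if "i \<in> F" "t \<ge> 0" for i t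
    unfolding K_def using that E F by (intro multiplier_cone_generator) auto

  obtain S where S: "S \<subseteq> v0 ` (E \<union> N)" "independent S" "v0 ` (E \<union> N) \<subseteq> span S"
    "card S = dim (v0 ` (E \<union> N))"
    using basis_exists by blast
  from S(1) obtain B where B: "B \<subseteq> E \<union> N" "inj_on v0 B" "S = v0 ` B"
    by (auto simp: subset_image_inj)
  have finB: "finite B" using B(1) E F N by (meson finite_Un finite_subset)
  have span_B: "span (v0 ` B) \<subseteq> K"
    using K_span span_mono[OF S(1)] B(3) by auto
  define I where "I = B \<union> (F - N)"
  have finI: "finite I" using finB F by (simp add: I_def)
  have BF: "B \<inter> (F - N) = {}" using B(1) EF by auto
  have sum_I: "(\<Sum>i\<in>I. y i *\<^sub>R u i) = (\<Sum>i\<in>B. y i *\<^sub>R u i) + (\<Sum>i\<in>F - N. y i *\<^sub>R u i)"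
    for y and u :: "'i \<Rightarrow> 'e"
    unfolding I_def using finB F BF by (intro sum.union_disjoint) auto
  have sum_span: "(\<Sum>i\<in>T. y i *\<^sub>R u i) \<in> span (u ` T)" for y T and u :: "'i \<Rightarrow> 'e"
    by (intro span_sum span_scale span_base) auto

  have pos_indep: "\<forall>i\<in>I. y i = 0"
    if y: "\<And>j. j \<in> F - N \<Longrightarrow> y j \<ge> 0" and y_sum: "(\<Sum>i\<in>I. y i *\<^sub>R v0 i) = 0" for y
  proof -
    \<comment> \<open>A positive coefficient would allow to solve for \<open>- v0 j\<close> and put \<open>j\<close> into \<open>N\<close>.\<close>
    have y0: "y j = 0" if j: "j \<in> F - N" for j
    proof (rule ccontr)
      assume "y j \<noteq> 0"
      then have pos: "y j > 0" using y[OF j] by simp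
      define R where "R = (\<Sum>i\<in>B. y i *\<^sub>R v0 i) + (\<Sum>i\<in>F - N - {j}. y i *\<^sub>R v0 i)"
      have "R \<in> K"
      proof -
        have "(\<Sum>i\<in>B. y i *\<^sub>R v0 i) \<in> K" using span_B sum_span by blast
        moreover have "(\<Sum>i\<in>F - N - {j}. y i *\<^sub>R v0 i) \<in> K"
          using K_gen y unfolding K_def by (intro multiplier_cone_sum) auto
        ultimately show ?thesis unfolding R_def K_def by (rule multiplier_cone_add)
      qed
      moreover have "y j *\<^sub>R v0 j + R = 0"
        using y_sum F j unfolding sum_I R_def by (simp add: sum.remove[of "F - N" j] algebra_simps)
      then have "- v0 j = inverse (y j) *\<^sub>R R"
        using pos by (metis add_eq_0_iff inverse_1 left_inverse less_irrefl
            scaleR_minus_right scaleR_one scaleR_scaleR minus_minus)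
      ultimately have "- v0 j \<in> K"
        using pos unfolding K_def by (simp add: multiplier_cone_scale)
      then have "j \<in> N" using j by (simp add: N_def reversible_indices_def K_def)
      then show False using j by simp
    qed
    then have "(\<Sum>i\<in>B. y i *\<^sub>R v0 i) = 0" using y_sum by (simp add: sum_I)
    then have "\<forall>i\<in>B. y i = 0"
      using independent_family_iff[OF finB, of v0] B S(2) by blast
    then show ?thesis using y0 by (auto simp: I_def)
  qed
  obtain \<delta> where \<delta>: "\<delta> > 0"
    and low: "\<And>w y. \<lbrakk>\<And>i. i \<in> I \<Longrightarrow> norm (w i - v0 i) \<le> \<delta>; \<And>j. j \<in> F - N \<Longrightarrow> y j \<ge> 0\<rbrakk> \<Longrightarrow>
           \<delta> * (\<Sum>i\<in>I. \<bar>y i\<bar>) \<le> norm (\<Sum>i\<in>I. y i *\<^sub>R w i)"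
    using positive_independence_stable[OF finI _ pos_indep] unfolding I_def by blast

  have I_sub: "I \<subseteq> E \<union> F" using B(1) N by (auto simp: I_def)
  have "\<forall>\<^sub>F k in sequentially. \<forall>i\<in>I. norm (v k i - v0 i) \<le> \<delta>"
  proof (intro eventually_ball_finite finI ballI)
    fix i assume "i \<in> I"
    then have "(\<lambda>k. v k i) \<longlonglongrightarrow> v0 i" using v I_sub by blast
    from tendstoD[OF this \<delta>] show "\<forall>\<^sub>F k in sequentially. norm (v k i - v0 i) \<le> \<delta>"
      by eventually_elim (simp add: dist_norm)
  qed
  from eventually_conj[OF this rank] obtain k0 where
    near: "\<And>k i. k \<ge> k0 \<Longrightarrow> i \<in> I \<Longrightarrow> norm (v k i - v0 i) \<le> \<delta>" and
    dim_k: "\<And>k. k \<ge> k0 \<Longrightarrow> dim (v k ` (E \<union> N)) = dim (v0 ` (E \<union> N))"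
    unfolding eventually_sequentially N_def by blast

  have "\<exists>z. (\<forall>j\<in>F - N. z j \<ge> 0) \<and> (\<Sum>i\<in>E \<union> F. x k i *\<^sub>R v k i) = (\<Sum>i\<in>I. z i *\<^sub>R v k i)"
    if k: "k \<ge> k0" for k
  proof -
    \<comment> \<open>Coefficients supported on \<open>B\<close> satisfy the sign condition vacuously, so the lower bound
      applies to all of them and \<open>B\<close> stays independent; constant rank makes it spanning.\<close>
    have "inj_on (v k) B \<and> independent (v k ` B)"
      unfolding independent_family_iff[OF finB]
    proof (intro allI impI ballI)
      fix y b assume y: "(\<Sum>b\<in>B. y b *\<^sub>R v k b) = 0" and b: "b \<in> B"
      define y' where "y' i = (if i \<in> B then y i else 0)" for i
      have y'0: "y' j = 0" if "j \<in> F - N" for j using that BF by (auto simp: y'_def)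
      have "(\<Sum>i\<in>I. y' i *\<^sub>R v k i) = 0"
        using y y'0 by (simp add: sum_I y'_def)
      then have "\<delta> * (\<Sum>i\<in>I. \<bar>y' i\<bar>) \<le> 0"
        using low[of "v k" y'] near[OF k] y'0 by simp
      then have "(\<Sum>i\<in>I. \<bar>y' i\<bar>) \<le> 0" using \<delta> by (simp add: mult_le_0_iff)
      then have "\<bar>y' b\<bar> \<le> 0"
        using member_le_sum[of b I "\<lambda>i. \<bar>y' i\<bar>"] finI b by (simp add: I_def)
      then show "y b = 0" using b by (simp add: y'_def)
    qed
    moreover have "card B = dim (v k ` (E \<union> N))"
      using S(4) B(2,3) dim_k[OF k] by (simp add: card_image)
    ultimately have "v k ` (E \<union> N) \<subseteq> span (v k ` B)"
      using B(1) by (intro card_ge_dim_independent) (auto simp: card_image)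
    then have "span (v k ` (E \<union> N)) \<subseteq> span (v k ` B)" by (simp add: span_minimal)
    then have "(\<Sum>i\<in>E \<union> N. x k i *\<^sub>R v k i) \<in> span (v k ` B)" using sum_span by blast
    from span_image_finite[OF finB this] obtain y where
      y: "(\<Sum>i\<in>E \<union> N. x k i *\<^sub>R v k i) = (\<Sum>b\<in>B. y b *\<^sub>R v k b)" by blast
    define z where "z i = (if i \<in> B then y i else x k i)" for i
    have z: "z j = x k j" if "j \<in> F - N" for j using that BF by (auto simp: z_def)
    have "E \<union> F = (E \<union> N) \<union> (F - N)" using N by auto
    then have "(\<Sum>i\<in>E \<union> F. x k i *\<^sub>R v k i) =
        (\<Sum>i\<in>E \<union> N. x k i *\<^sub>R v k i) + (\<Sum>i\<in>F - N. x k i *\<^sub>R v k i)"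
      using E F N EF finite_subset[OF N F] by (simp, intro sum.union_disjoint) auto
    also have "\<dots> = (\<Sum>i\<in>I. z i *\<^sub>R v k i)"
      using z by (simp add: sum_I y) (simp add: z_def)
    finally show ?thesis using z x by (intro exI[of _ z]) auto
  qed
  then obtain z where z0: "\<And>k j. k \<ge> k0 \<Longrightarrow> j \<in> F - N \<Longrightarrow> z k j \<ge> 0"
    and z: "\<And>k. k \<ge> k0 \<Longrightarrow> (\<Sum>i\<in>E \<union> F. x k i *\<^sub>R v k i) = (\<Sum>i\<in>I. z k i *\<^sub>R v k i)"
    by metis

  define s where "s k = (\<Sum>i\<in>E \<union> F. x k i *\<^sub>R v k i)" for k
  have s: "s \<longlonglongrightarrow> - c0"
    using tendsto_diff[OF stat c] unfolding s_def by simp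
  then have "bounded (range s)" by (rule convergent_imp_bounded)
  then obtain C where C: "\<And>k. norm (s k) \<le> C" by (auto simp: bounded_iff)
  \<comment> \<open>The combinations converge, so the lower bound keeps the new coefficients bounded.\<close>
  have z_le: "\<bar>z (k + k0) i\<bar> \<le> C / \<delta>" if i: "i \<in> I" for k i
  proof -
    have "\<delta> * \<bar>z (k + k0) i\<bar> \<le> \<delta> * (\<Sum>i\<in>I. \<bar>z (k + k0) i\<bar>)"
      using \<delta> i finI by (intro mult_left_mono member_le_sum) auto
    also have "\<dots> \<le> norm (s (k + k0))"
      unfolding s_def using near z0 by (subst z) (auto intro!: low)
    also note C
    finally show ?thesis using \<delta> by (simp add: field_simps)
  qed
  obtain l r where
    r: "strict_mono r" and l: "\<And>i. i \<in> I \<Longrightarrow> (\<lambda>k. z (r k + k0) i) \<longlonglongrightarrow> l i"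
    using bounded_family_convergent_subsequence[where x = "\<lambda>k. z (k + k0)", OF finI z_le]
    by blast
  have v_r: "(\<lambda>k. v (r k + k0) i) \<longlonglongrightarrow> v0 i" if "i \<in> I" for i
    using LIMSEQ_subseq_LIMSEQ[OF LIMSEQ_ignore_initial_segment[OF v, of i k0] r] that I_sub
    by (auto simp: o_def)
  have "(\<lambda>k. s (r k + k0)) \<longlonglongrightarrow> (\<Sum>i\<in>I. l i *\<^sub>R v0 i)"
    unfolding s_def z[OF le_add2] by (intro tendsto_intros l v_r)
  moreover have "(\<lambda>k. s (r k + k0)) \<longlonglongrightarrow> - c0"
    using LIMSEQ_subseq_LIMSEQ[OF LIMSEQ_ignore_initial_segment[OF s, of k0] r]
    by (simp add: o_def)
  ultimately have "- c0 = (\<Sum>i\<in>B. l i *\<^sub>R v0 i) + (\<Sum>i\<in>F - N. l i *\<^sub>R v0 i)"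
    using LIMSEQ_unique sum_I by metis
  moreover have "l j \<ge> 0" if "j \<in> F - N" for j
    using that z0 by (intro LIMSEQ_le_const[OF l]) (auto simp: I_def)
  then have "(\<Sum>i\<in>F - N. l i *\<^sub>R v0 i) \<in> K"
    using K_gen unfolding K_def by (intro multiplier_cone_sum) auto
  moreover have "(\<Sum>i\<in>B. l i *\<^sub>R v0 i) \<in> K" using span_B sum_span by blast
  ultimately show ?thesis unfolding K_def by (simp add: multiplier_cone_add)
qed

section \<open>Bilinear forms and linear images\<close>

text \<open>The classical argument, for a form that is not the inner product of its type: evaluate the form on
the component of \<open>u\<close> orthogonal to \<open>v\<close>.\<close>
lemma bilinear_cauchy_schwarz:
  fixes B :: "'e::real_vector \<Rightarrow> 'e \<Rightarrow> real"
  assumes B: "bilinear B" and sym: "\<And>u v. B u v = B v u"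
    and pos: "\<And>v. v \<noteq> 0 \<Longrightarrow> B v v > 0"
  shows "\<bar>B u v\<bar> \<le> sqrt (B u u) * sqrt (B v v)"
proof (cases "v = 0")
  case True
  then show ?thesis using B by (simp add: bilinear_rzero)
next
  case False
  then have v: "B v v > 0" by (rule pos)
  define t where "t = B u v / B v v"
  have "0 \<le> B (u - t *\<^sub>R v) (u - t *\<^sub>R v)"
    using pos[of "u - t *\<^sub>R v"] B by (cases "u - t *\<^sub>R v = 0") (auto simp: bilinear_rzero less_imp_le)
  also have "\<dots> = B u u - t * B u v - t * B u v + t * t * B v v"
    using B by (simp add: bilinear_lsub bilinear_rsub bilinear_lmul bilinear_rmul sym[of v u])
  also have "\<dots> = B u u - (B u v)\<^sup>2 / B v v"
    using v by (simp add: t_def power2_eq_square field_simps)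
  finally have "(B u v)\<^sup>2 \<le> B u u * B v v" using v by (simp add: field_simps)
  then have "sqrt ((B u v)\<^sup>2) \<le> sqrt (B u u * B v v)" by (rule real_sqrt_le_mono)
  then show ?thesis by (simp add: real_sqrt_mult)
qed

text \<open>The codomain may be infinite-dimensional; the families of coordinates that represent tangent
vectors live in such a space.\<close>
lemma dim_injective_linear_image:
  fixes S :: "'e::euclidean_space \<Rightarrow> 'f::real_vector"
  assumes S: "linear S" "inj S"
  shows "dim (S ` V) = dim V"
proof -
  obtain B where B: "B \<subseteq> V" "independent B" "V \<subseteq> span B" "card B = dim V"
    using basis_exists by blast
  have "span (S ` B) = span (S ` V)"
    using B(1,3) by (simp add: linear_span_image[OF S(1)] span_eq span_superset span_mono)
      (metis B(1) span_eq span_superset subset_trans)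
  moreover have "independent (S ` B)"
    using B(2) S by (simp add: linear_independent_injective_image inj_on_subset)
  ultimately have "dim (S ` V) = card (S ` B)" by (rule dim_eq_card)
  then show ?thesis using B(4) S(2) by (simp add: card_image inj_on_subset)
qed

text \<open>The bound depends on the form only through its coefficients, so it is uniform over a family of forms
with bounded coefficients, such as the metric near a point.\<close>
lemma bilinear_form_le_norm:
  fixes B :: "'e::euclidean_space \<Rightarrow> 'e \<Rightarrow> real"
  assumes B: "bilinear B"
  shows "B u u \<le> (\<Sum>b\<in>Basis. \<Sum>b'\<in>Basis. \<bar>B b b'\<bar>) * (norm u)\<^sup>2"
proof -
  have "B u u = B (\<Sum>b\<in>Basis. (u \<bullet> b) *\<^sub>R b) (\<Sum>b\<in>Basis. (u \<bullet> b) *\<^sub>R b)"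
    by (simp add: euclidean_representation)
  also have "\<dots> = (\<Sum>b\<in>Basis. \<Sum>b'\<in>Basis. (u \<bullet> b) * ((u \<bullet> b') * B b b'))"
    by (simp add: bilinear_sum[OF B] sum.cartesian_product bilinear_lmul[OF B] bilinear_rmul[OF B] mult_ac)
  also have "\<dots> \<le> (\<Sum>b\<in>Basis. \<Sum>b'\<in>Basis. \<bar>B b b'\<bar> * (norm u)\<^sup>2)"
  proof (intro sum_mono)
    fix b b' :: 'e assume b: "b \<in> Basis" "b' \<in> Basis"
    have "(u \<bullet> b) * ((u \<bullet> b') * B b b') \<le> \<bar>u \<bullet> b\<bar> * (\<bar>u \<bullet> b'\<bar> * \<bar>B b b'\<bar>)"
      by (metis abs_ge_self abs_mult)
    also have "\<dots> \<le> norm u * (norm u * \<bar>B b b'\<bar>)"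
      using b by (intro mult_mono Basis_le_norm) auto
    finally show "(u \<bullet> b) * ((u \<bullet> b') * B b b') \<le> \<bar>B b b'\<bar> * (norm u)\<^sup>2"
      by (simp add: power2_eq_square mult_ac)
  qed
  finally show ?thesis by (simp add: sum_distrib_right)
qed

section \<open>Tangent vectors in a chart\<close>

text \<open>The Euclidean gradient of the coordinate expression of \<open>F\<close>.\<close>
definition chart_gradient ::
  "('a, 'e::euclidean_space) chart \<Rightarrow> ('a \<Rightarrow> real) \<Rightarrow> 'e \<Rightarrow> 'e" where
  "chart_gradient c F x =
     (\<Sum>b\<in>Basis. frechet_derivative (F \<circ> inv_chart c) (at x) b *\<^sub>R b)"

lemma continuous_on_chart_gradient:
  assumes "Ck_on 1 S (F \<circ> inv_chart c)"
  shows "continuous_on S (chart_gradient c F)"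
  using assms unfolding chart_gradient_def
  by (auto intro!: continuous_intros)

lemma chart_gradient_lagrangian:
  fixes c :: "('a, 'e::euclidean_space) chart"
  assumes f: "(f \<circ> inv_chart c) differentiable (at x)"
    and h: "\<And>i. i \<in> {1..s} \<Longrightarrow> (h i \<circ> inv_chart c) differentiable (at x)"
    and g: "\<And>j. j \<in> {1..m} \<Longrightarrow> (g j \<circ> inv_chart c) differentiable (at x)"
  shows "(lagrangian s m f h g lam \<mu> \<circ> inv_chart c) differentiable (at x)"
    and "chart_gradient c (lagrangian s m f h g lam \<mu>) x = chart_gradient c f x +
      (\<Sum>i=1..s. lam i *\<^sub>R chart_gradient c (h i) x) + (\<Sum>j=1..m. \<mu> j *\<^sub>R chart_gradient c (g j) x)"
proof -
  let ?d = "\<lambda>F. frechet_derivative (F \<circ> inv_chart c) (at x)"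
  have der: "((\<lambda>y. F (inv_chart c y)) has_derivative ?d F) (at x)"
    if "(F \<circ> inv_chart c) differentiable (at x)" for F :: "'a \<Rightarrow> real"
    using that by (simp add: frechet_derivative_works o_def)
  have L: "(lagrangian s m f h g lam \<mu> \<circ> inv_chart c has_derivative
      (\<lambda>u. ?d f u + (\<Sum>i=1..s. lam i * ?d (h i) u) + (\<Sum>j=1..m. \<mu> j * ?d (g j) u))) (at x)"
    unfolding lagrangian_def comp_def[of _ "inv_chart c"]
    by (intro has_derivative_add has_derivative_sum has_derivative_mult_right
        der[unfolded comp_def] f[unfolded comp_def] h[unfolded comp_def] g[unfolded comp_def])
  then show "(lagrangian s m f h g lam \<mu> \<circ> inv_chart c) differentiable (at x)"
    unfolding differentiable_def by blast
  have swap: "(\<Sum>b\<in>Basis. (\<Sum>i\<in>I. k i * d i b) *\<^sub>R b) = (\<Sum>i\<in>I. k i *\<^sub>R (\<Sum>b\<in>Basis. d i b *\<^sub>R b))"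
    for I :: "nat set" and k :: "nat \<Rightarrow> real" and d :: "nat \<Rightarrow> 'e \<Rightarrow> real"
    by (simp add: scaleR_sum_left scaleR_sum_right) (rule sum.swap)
  show "chart_gradient c (lagrangian s m f h g lam \<mu>) x = chart_gradient c f x +
      (\<Sum>i=1..s. lam i *\<^sub>R chart_gradient c (h i) x) + (\<Sum>j=1..m. \<mu> j *\<^sub>R chart_gradient c (g j) x)"
    unfolding chart_gradient_def frechet_derivative_at[OF L, symmetric]
    by (simp add: scaleR_add_left sum.distrib swap)
qed

context
  fixes A :: "('a::topological_space, 'e::euclidean_space) chart set"
    and G :: "('a, 'e) metric"
  assumes riem: "riemannian_manifold A G"
begin

lemma chart_homeomorphism:
  assumes "c \<in> A"
  shows "open (fst c)" "open (snd c ` fst c)"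
    "homeomorphism (fst c) (snd c ` fst c) (snd c) (inv_chart c)"
  using riem assms by (auto simp: riemannian_manifold_def smooth_atlas_def is_chart_def)

lemma inv_chart_coord:
  assumes "c \<in> A" "q \<in> fst c"
  shows "inv_chart c (snd c q) = q"
  using chart_homeomorphism(3)[OF assms(1)] assms(2) by (simp add: homeomorphism_apply1)

lemma coord_inv_chart:
  assumes "c \<in> A" "x \<in> snd c ` fst c"
  shows "snd c (inv_chart c x) = x" "inv_chart c x \<in> fst c"
  using chart_homeomorphism(3)[OF assms(1)] assms(2) inv_chart_coord[OF assms(1)]
  by (auto simp: homeomorphism_apply2)

lemma open_chart_overlap:
  assumes "c \<in> A" "c' \<in> A"
  shows "open (snd c ` (fst c \<inter> fst c'))"
proof -
  have "openin (top_of_set (fst c)) (fst c \<inter> fst c')"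
    using chart_homeomorphism(1)[OF assms(2)] by (rule openin_open_Int)
  from homeomorphism_imp_open_map[OF chart_homeomorphism(3)[OF assms(1)] this]
  show ?thesis using chart_homeomorphism(2)[OF assms(1)] by (simp add: openin_open_eq)
qed

lemma transition_C1:
  assumes "c \<in> A" "c' \<in> A"
  shows "Ck_on 1 (snd c ` (fst c \<inter> fst c')) (snd c' \<circ> inv_chart c)"
  using riem assms
  by (simp add: riemannian_manifold_def smooth_atlas_def smooth_on_def del: One_nat_def)

lemma transition_differentiable:
  assumes "c \<in> charts_at A q" "c' \<in> charts_at A q"
  shows "(snd c' \<circ> inv_chart c) differentiable (at (snd c q))"
  using transition_C1[of c c'] assms by (auto simp: charts_at_def)

text \<open>On the overlap, the expression of \<open>F\<close> in \<open>c\<close> is its expression in \<open>c'\<close> after the transition map;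
outside the overlap this composition is meaningless, so the chain rule is used on an open set only.
With \<open>F\<close> a coordinate map, this is the cocycle rule for transition maps.\<close>
lemma has_derivative_change_chart:
  fixes F :: "'a \<Rightarrow> 'f::real_normed_vector"
  assumes c: "c \<in> charts_at A q" and c': "c' \<in> charts_at A q"
    and F: "(F \<circ> inv_chart c') differentiable (at (snd c' q))"
  shows "((F \<circ> inv_chart c) has_derivative
    (frechet_derivative (F \<circ> inv_chart c') (at (snd c' q)) \<circ>
     frechet_derivative (snd c' \<circ> inv_chart c) (at (snd c q)))) (at (snd c q))"
proof -
  have A: "c \<in> A" "c' \<in> A" and q: "q \<in> fst c" "q \<in> fst c'"
    using c c' by (auto simp: charts_at_def)
  have "snd c' q = (snd c' \<circ> inv_chart c) (snd c q)"
    using inv_chart_coord[OF A(1) q(1)] by simp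
  with F have "((F \<circ> inv_chart c') has_derivative
      frechet_derivative (F \<circ> inv_chart c') (at (snd c' q)))
      (at ((snd c' \<circ> inv_chart c) (snd c q)))"
    by (simp add: frechet_derivative_works)
  from diff_chain_at[OF frechet_derivative_works[THEN iffD1, OF transition_differentiable[OF c c']] this]
  show ?thesis
    by (rule has_derivative_transform_within_open[OF _ open_chart_overlap[OF A]])
       (use q in \<open>auto simp: inv_chart_coord A\<close>)
qed

lemma frechet_derivative_change_chart:
  fixes F :: "'a \<Rightarrow> 'f::real_normed_vector"
  assumes "c \<in> charts_at A q" "c' \<in> charts_at A q"
    and "(F \<circ> inv_chart c') differentiable (at (snd c' q))"
  shows "frechet_derivative (F \<circ> inv_chart c) (at (snd c q)) u =
     frechet_derivative (F \<circ> inv_chart c') (at (snd c' q))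
       (frechet_derivative (snd c' \<circ> inv_chart c) (at (snd c q)) u)"
  using frechet_derivative_at[OF has_derivative_change_chart[OF assms]]
  by (metis comp_apply)

lemma coord_vector_in_chart:
  assumes c: "c \<in> charts_at A q"
  shows "coord_vector A c q u c = u"
proof -
  have A: "c \<in> A" "q \<in> fst c" using c by (auto simp: charts_at_def)
  have "((snd c \<circ> inv_chart c) has_derivative (\<lambda>u. u)) (at (snd c q))"
    by (rule has_derivative_transform_within_open[OF has_derivative_ident chart_homeomorphism(2)[OF A(1)]])
       (use A in \<open>auto simp: inv_chart_coord\<close>)
  from frechet_derivative_at[OF this] c show ?thesis
    unfolding coord_vector_def by metis
qed

lemma coord_vector_in_tangent_space:
  assumes c: "c \<in> charts_at A q"
  shows "coord_vector A c q u \<in> tangent_space A q"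
  unfolding tangent_space_def
proof (intro CollectI conjI ballI allI impI)
  show "coord_vector A c q u c' = 0" if "c' \<notin> charts_at A q" for c'
    using that by (simp add: coord_vector_def)
  fix c' c'' assume c': "c' \<in> charts_at A q" and c'': "c'' \<in> charts_at A q"
  show "coord_vector A c q u c'' =
      frechet_derivative (snd c'' \<circ> inv_chart c') (at (snd c' q)) (coord_vector A c q u c')"
    using frechet_derivative_change_chart[OF c c' transition_differentiable[OF c' c''], of u] c' c''
    by (simp add: coord_vector_def)
qed

text \<open>Together with \<open>coord_vector_in_chart\<close> this identifies the tangent space with the coordinate space
of any one chart.\<close>
lemma tangent_eq_coord_vector:
  assumes "c \<in> charts_at A q" "v \<in> tangent_space A q"
  shows "v = coord_vector A c q (v c)"
proof
  fix c'
  have v: "c' \<notin> charts_at A q \<Longrightarrow> v c' = 0"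
    "c' \<in> charts_at A q \<Longrightarrow> v c' = frechet_derivative (snd c' \<circ> inv_chart c) (at (snd c q)) (v c)"
    using assms unfolding tangent_space_def by blast+
  show "v c' = coord_vector A c q (v c) c'"
  proof (cases "c' \<in> charts_at A q")
    case True
    show ?thesis unfolding coord_vector_def if_P[OF True] by (rule v(2)[OF True])
  next
    case False
    show ?thesis unfolding coord_vector_def if_not_P[OF False] by (rule v(1)[OF False])
  qed
qed

lemma linear_coord_vector:
  assumes c: "c \<in> charts_at A q"
  shows "linear (coord_vector A c q)"
proof -
  have "linear (frechet_derivative (snd c' \<circ> inv_chart c) (at (snd c q)))" if "c' \<in> charts_at A q" for c'
    using transition_differentiable[OF c that] by (rule linear_frechet_derivative)
  then show ?thesis
    by (intro linearI) (auto simp: coord_vector_def fun_eq_iff plus_fun_def scaleR_fun_def linear_add linear_scale)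
qed

lemma differential_coord_vector:
  assumes c: "c \<in> charts_at A q" and F: "(F \<circ> inv_chart c) differentiable (at (snd c q))"
  shows "differential A F q (coord_vector A c q u) =
    frechet_derivative (F \<circ> inv_chart c) (at (snd c q)) u"
proof -
  define d where "d = (SOME c. c \<in> charts_at A q)"
  have d: "d \<in> charts_at A q" using c unfolding d_def by (rule someI)
  have Fd: "(F \<circ> inv_chart d) differentiable (at (snd d q))"
    using has_derivative_change_chart[OF d c F] unfolding differentiable_def by blast
  show ?thesis
    using frechet_derivative_change_chart[OF c d Fd, of u] d
    by (simp add: differential_def d_def[symmetric] coord_vector_def)
qed

section \<open>The gradient in a chart\<close>

lemma metric_in_chart:
  assumes c: "c \<in> charts_at A q"
  shows "bilinear (\<lambda>u w. G q (coord_vector A c q u) (coord_vector A c q w))"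
    and "G q (coord_vector A c q u) (coord_vector A c q w) =
         G q (coord_vector A c q w) (coord_vector A c q u)"
    and "u \<noteq> 0 \<Longrightarrow> G q (coord_vector A c q u) (coord_vector A c q u) > 0"
proof -
  note T = coord_vector_in_tangent_space[OF c]
  note lin = linear_coord_vector[OF c]
  have G: "riemannian_metric A G" using riem by (simp add: riemannian_manifold_def)
  show sym: "G q (coord_vector A c q u) (coord_vector A c q w) =
         G q (coord_vector A c q w) (coord_vector A c q u)" for u w
    using G T unfolding riemannian_metric_def by blast
  have comb: "G q (a *\<^sub>R coord_vector A c q u + b *\<^sub>R coord_vector A c q v) (coord_vector A c q w) =
      a * G q (coord_vector A c q u) (coord_vector A c q w) +
      b * G q (coord_vector A c q v) (coord_vector A c q w)" for a b u v w
    using G T unfolding riemannian_metric_def by blast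
  have add: "G q (coord_vector A c q (u + v)) (coord_vector A c q w) =
      G q (coord_vector A c q u) (coord_vector A c q w) +
      G q (coord_vector A c q v) (coord_vector A c q w)" for u v w
    using comb[of 1 u 1 v w] by (simp add: linear_add[OF lin])
  have scale: "G q (coord_vector A c q (a *\<^sub>R u)) (coord_vector A c q w) =
      a * G q (coord_vector A c q u) (coord_vector A c q w)" for a u w
    using comb[of a u 0 0 w] by (simp add: linear_scale[OF lin])
  show "bilinear (\<lambda>u w. G q (coord_vector A c q u) (coord_vector A c q w))"
    unfolding bilinear_def
    by (auto intro!: linearI simp: add scale sym[of _ "_ + _"] sym[of _ "_ *\<^sub>R _"]) (simp_all add: sym)
  show "G q (coord_vector A c q u) (coord_vector A c q u) > 0" if "u \<noteq> 0"
  proof -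
    have "coord_vector A c q u \<noteq> 0"
      using that coord_vector_in_chart[OF c, of u] by (metis zero_fun_apply)
    then show ?thesis using G T unfolding riemannian_metric_def by blast
  qed
qed

text \<open>In the chart the metric is an inner product \<open>B\<close>. It defines a linear map \<open>M\<close> that sends \<open>u\<close> to the
vector representing \<open>B u\<close> in the Euclidean inner product; \<open>M\<close> is injective because \<open>B\<close> is positive
definite, hence bijective. The gradient of \<open>F\<close> is the tangent vector whose coordinates are the
preimage under \<open>M\<close> of the coordinate gradient. This also proves that the gradient exists and is unique.\<close>
lemma grad_musical_isomorphism:
  assumes c: "c \<in> charts_at A q"
  obtains S where "linear S" "inj S" "range S \<subseteq> tangent_space A q"
    and "\<And>F. (F \<circ> inv_chart c) differentiable (at (snd c q)) \<Longrightarrow>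
           grad A G F q = S (chart_gradient c F (snd c q))"
    and "\<And>F u. (F \<circ> inv_chart c) differentiable (at (snd c q)) \<Longrightarrow>
           G q (grad A G F q) (coord_vector A c q u) =
             frechet_derivative (F \<circ> inv_chart c) (at (snd c q)) u"
proof -
  define X where "X = coord_vector A c q"
  define B where "B u w = G q (X u) (X w)" for u w
  have B: "bilinear B" and sym: "\<And>u w. B u w = B w u" and pos: "\<And>u. u \<noteq> 0 \<Longrightarrow> B u u > 0"
    using metric_in_chart[OF c] unfolding B_def X_def by blast+
  have linX: "linear X" unfolding X_def by (rule linear_coord_vector[OF c])
  define M where "M u = (\<Sum>b\<in>Basis. B u b *\<^sub>R b)" for u
  have linM: "linear M"
    using B by (intro linearI)
      (simp_all add: M_def bilinear_ladd bilinear_lmul scaleR_add_left sum.distrib scaleR_sum_right)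
  have M_inner: "M u \<bullet> w = B u w" for u w
  proof -
    have "B u w = B u (\<Sum>b\<in>Basis. (w \<bullet> b) *\<^sub>R b)" by (simp add: euclidean_representation)
    also have "\<dots> = (\<Sum>b\<in>Basis. (w \<bullet> b) * B u b)"
      using B by (simp add: bilinear_def linear_sum linear_scale)
    also have "\<dots> = M u \<bullet> w"
      by (simp add: M_def inner_sum_left inner_commute[of w] mult.commute)
    finally show ?thesis by simp
  qed
  have injM: "inj M"
    unfolding linear_injective_0[OF linM]
    using M_inner pos by (metis inner_zero_left less_irrefl)
  have surjM: "surj M" using linear_injective_imp_surjective[OF linM injM] by simp
  obtain M' where linM': "linear M'" and M': "M' \<circ> M = id"
    using linear_injective_left_inverse[OF linM injM] by blast
  have MM': "M (M' y) = y" for y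
    using surjM M' by (metis comp_apply id_apply surjD)
  have injX: "inj X" unfolding X_def by (metis coord_vector_in_chart[OF c] injI)
  have B_grad: "B (M' (chart_gradient c F (snd c q))) w =
      frechet_derivative (F \<circ> inv_chart c) (at (snd c q)) w"
    if F: "(F \<circ> inv_chart c) differentiable (at (snd c q))" for F w
  proof -
    have "B (M' (chart_gradient c F (snd c q))) w = chart_gradient c F (snd c q) \<bullet> w"
      by (simp add: M_inner[symmetric] MM')
    also have "\<dots> = (\<Sum>b\<in>Basis. (w \<bullet> b) * frechet_derivative (F \<circ> inv_chart c) (at (snd c q)) b)"
      by (simp add: chart_gradient_def inner_sum_left inner_commute[of w] mult.commute)
    also have "\<dots> = frechet_derivative (F \<circ> inv_chart c) (at (snd c q)) (\<Sum>b\<in>Basis. (w \<bullet> b) *\<^sub>R b)"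
      using linear_frechet_derivative[OF F] by (simp add: linear_sum linear_scale)
    finally show ?thesis by (simp add: euclidean_representation)
  qed
  have X_T: "X u \<in> tangent_space A q" for u
    unfolding X_def by (rule coord_vector_in_tangent_space[OF c])
  have T_X: "\<exists>u. v = X u" if "v \<in> tangent_space A q" for v
    unfolding X_def using tangent_eq_coord_vector[OF c that] by blast
  have grad: "grad A G F q = X (M' (chart_gradient c F (snd c q)))"
    if F: "(F \<circ> inv_chart c) differentiable (at (snd c q))" for F
    unfolding grad_def
  proof (rule the_equality, intro conjI ballI)
    let ?u = "M' (chart_gradient c F (snd c q))"
    show "X ?u \<in> tangent_space A q" by (rule X_T)
    fix v assume "v \<in> tangent_space A q"
    then obtain w where w: "v = X w" using T_X by blast
    show "G q (X ?u) v = differential A F q v"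
      unfolding w using B_grad[OF F, of w] differential_coord_vector[OF c F, of w]
      by (simp add: B_def X_def)
  next
    let ?u = "M' (chart_gradient c F (snd c q))"
    fix v assume v: "v \<in> tangent_space A q \<and> (\<forall>w\<in>tangent_space A q. G q v w = differential A F q w)"
    then obtain u where u: "v = X u" using T_X by blast
    have "B u w = B ?u w" for w
      using v X_T[of w] B_grad[OF F, of w] differential_coord_vector[OF c F, of w]
      by (simp add: u B_def X_def)
    then have "B (u - ?u) (u - ?u) = 0" using B by (simp add: bilinear_lsub)
    then have "u = ?u" using pos[of "u - ?u"] by fastforce
    then show "v = X ?u" using u by simp
  qed
  show thesis
  proof (rule that[of "X \<circ> M'"])
    show "linear (X \<circ> M')" using linM' linX by (rule linear_compose)
    show "inj (X \<circ> M')" using injX MM' by (metis inj_compose injI)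
    show "range (X \<circ> M') \<subseteq> tangent_space A q" using X_T by auto
    show "grad A G F q = (X \<circ> M') (chart_gradient c F (snd c q))"
      if "(F \<circ> inv_chart c) differentiable (at (snd c q))" for F
      using grad[OF that] by simp
    show "G q (grad A G F q) (coord_vector A c q u) =
        frechet_derivative (F \<circ> inv_chart c) (at (snd c q)) u"
      if "(F \<circ> inv_chart c) differentiable (at (snd c q))" for F u
      using grad[OF that] B_grad[OF that] by (simp add: B_def X_def)
  qed
qed

lemma frechet_derivative_le_tangent_norm_grad:
  assumes c: "c \<in> charts_at A q" and F: "(F \<circ> inv_chart c) differentiable (at (snd c q))"
  shows "\<bar>frechet_derivative (F \<circ> inv_chart c) (at (snd c q)) u\<bar> \<le>
    tangent_norm G q (grad A G F q) * tangent_norm G q (coord_vector A c q u)"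
proof -
  obtain S where S: "range S \<subseteq> tangent_space A q"
    "grad A G F q = S (chart_gradient c F (snd c q))"
    "G q (grad A G F q) (coord_vector A c q u) =
       frechet_derivative (F \<circ> inv_chart c) (at (snd c q)) u"
    by (rule grad_musical_isomorphism[OF c]) (use F in blast)
  obtain w where w: "grad A G F q = coord_vector A c q w"
    using tangent_eq_coord_vector[OF c, of "grad A G F q"] S(1,2) by auto
  show ?thesis
    using bilinear_cauchy_schwarz[OF metric_in_chart[OF c], of w u]
    by (simp add: S(3)[symmetric] w tangent_norm_def)
qed

lemma continuous_on_metric_in_chart:
  assumes "c \<in> A"
  shows "continuous_on (snd c ` fst c) (\<lambda>x. G (inv_chart c x)
    (coord_vector A c (inv_chart c x) u) (coord_vector A c (inv_chart c x) w))"
proof -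
  have "Ck_on 0 (snd c ` fst c) (\<lambda>x. G (inv_chart c x)
    (coord_vector A c (inv_chart c x) u) (coord_vector A c (inv_chart c x) w))"
    using riem assms unfolding riemannian_manifold_def riemannian_metric_def smooth_on_def by blast
  then show ?thesis by simp
qed

lemma coord_tendsto:
  assumes c: "c \<in> charts_at A p" and P: "P \<longlonglongrightarrow> p"
  shows "\<forall>\<^sub>F k in sequentially. c \<in> charts_at A (P k)"
    and "(\<lambda>k. snd c (P k)) \<longlonglongrightarrow> snd c p"
proof -
  have A: "c \<in> A" "p \<in> fst c" using c by (auto simp: charts_at_def)
  have in_dom: "\<forall>\<^sub>F k in sequentially. P k \<in> fst c"
    using P A chart_homeomorphism(1) topological_tendstoD by blast
  then show "\<forall>\<^sub>F k in sequentially. c \<in> charts_at A (P k)"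
    using A by (simp add: charts_at_def)
  have "continuous_on (fst c) (snd c)"
    using chart_homeomorphism(3)[OF A(1)] by (simp add: homeomorphism_def)
  then show "(\<lambda>k. snd c (P k)) \<longlonglongrightarrow> snd c p"
    using P A(2) in_dom by (rule continuous_on_tendsto_compose)
qed

lemma tendsto_in_chart:
  assumes c: "c \<in> charts_at A p" and P: "P \<longlonglongrightarrow> p"
    and cont: "continuous_on (snd c ` fst c) \<phi>"
  shows "(\<lambda>k. \<phi> (snd c (P k))) \<longlonglongrightarrow> \<phi> (snd c p)"
proof -
  have "isCont \<phi> (snd c p)"
    using c cont chart_homeomorphism(2) by (auto simp: charts_at_def continuous_on_eq_continuous_at)
  then show ?thesis using coord_tendsto(2)[OF c P] by (rule isCont_tendsto_compose)
qed

text \<open>By Cauchy--Schwarz a partial derivative is at most the norm of the gradient times the norm of a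
coordinate vector field, and the latter stays bounded near \<open>p\<close>. The functions may vary with \<open>k\<close>,
as Lagrangians with changing multipliers do.\<close>
lemma chart_gradient_tendsto_0:
  assumes c: "c \<in> charts_at A p" and P: "P \<longlonglongrightarrow> p"
    and F: "\<forall>\<^sub>F k in sequentially. (F k \<circ> inv_chart c) differentiable (at (snd c (P k)))"
    and grad: "(\<lambda>k. tangent_norm G (P k) (grad A G (F k) (P k))) \<longlonglongrightarrow> 0"
  shows "(\<lambda>k. chart_gradient c (F k) (snd c (P k))) \<longlonglongrightarrow> 0"
proof -
  have A: "c \<in> A" using c by (auto simp: charts_at_def)
  have "(\<lambda>k. frechet_derivative (F k \<circ> inv_chart c) (at (snd c (P k))) b) \<longlonglongrightarrow> 0" for b
  proof -
    define \<nu> where "\<nu> x = tangent_norm G (inv_chart c x) (coord_vector A c (inv_chart c x) b)" for x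
    have "continuous_on (snd c ` fst c) \<nu>"
      unfolding \<nu>_def tangent_norm_def
      by (intro continuous_on_real_sqrt continuous_on_metric_in_chart A)
    from tendsto_mult[OF grad tendsto_in_chart[OF c P this]]
    have lim: "(\<lambda>k. tangent_norm G (P k) (grad A G (F k) (P k)) * \<nu> (snd c (P k))) \<longlonglongrightarrow> 0" by simp
    have "\<forall>\<^sub>F k in sequentially. norm (frechet_derivative (F k \<circ> inv_chart c) (at (snd c (P k))) b)
        \<le> tangent_norm G (P k) (grad A G (F k) (P k)) * \<nu> (snd c (P k))"
      using F coord_tendsto(1)[OF c P]
    proof eventually_elim
      case (elim k)
      then have "inv_chart c (snd c (P k)) = P k"
        by (auto simp: charts_at_def intro: inv_chart_coord)
      with frechet_derivative_le_tangent_norm_grad[OF elim(2,1), of b]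
      show ?case by (simp add: \<nu>_def)
    qed
    then show ?thesis by (rule Lim_null_comparison[OF _ lim])
  qed
  then have "(\<lambda>k. chart_gradient c (F k) (snd c (P k))) \<longlonglongrightarrow> (\<Sum>b\<in>Basis. 0 *\<^sub>R b)"
    unfolding chart_gradient_def by (intro tendsto_intros)
  then show ?thesis by simp
qed

section \<open>Small balls are neighbourhoods\<close>

text \<open>A \<open>C\<^sup>1\<close> curve has to be differentiable in every chart that it meets, not only in the chart where it
is straight. In a second chart its derivative is the image of the direction under the transition map.\<close>
lemma coordinate_line_derivative:
  assumes c: "c \<in> A" "c' \<in> A"
    and t: "x + t *\<^sub>R u \<in> snd c ` fst c" "inv_chart c (x + t *\<^sub>R u) \<in> fst c'"
  shows "((snd c' \<circ> (\<lambda>t. inv_chart c (x + t *\<^sub>R u))) has_vector_derivative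
    frechet_derivative (snd c' \<circ> inv_chart c) (at (x + t *\<^sub>R u)) u) (at t)"
proof -
  let ?q = "inv_chart c (x + t *\<^sub>R u)"
  have q: "c \<in> charts_at A ?q" "c' \<in> charts_at A ?q" "snd c ?q = x + t *\<^sub>R u"
    using c t coord_inv_chart[OF c(1) t(1)] by (auto simp: charts_at_def)
  have diff: "(snd c' \<circ> inv_chart c) differentiable (at (x + t *\<^sub>R u))"
    using transition_differentiable[OF q(1,2)] q(3) by simp
  have "((\<lambda>t. x + t *\<^sub>R u) has_derivative (\<lambda>s. s *\<^sub>R u)) (at t)"
    by (auto intro!: derivative_eq_intros)
  from diff_chain_at[OF this frechet_derivative_works[THEN iffD1, OF diff]]
  show ?thesis
    using linear_scale[OF linear_frechet_derivative[OF diff]]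
    by (simp add: has_vector_derivative_def o_def)
qed

lemma coordinate_line_vector_derivative:
  assumes "c \<in> A" "c' \<in> A" "t \<in> {0..1}"
    and "x + t *\<^sub>R u \<in> snd c ` fst c" "inv_chart c (x + t *\<^sub>R u) \<in> fst c'"
  shows "vector_derivative (snd c' \<circ> (\<lambda>t. inv_chart c (x + t *\<^sub>R u))) (at t within {0..1}) =
    frechet_derivative (snd c' \<circ> inv_chart c) (at (x + t *\<^sub>R u)) u"
  using vector_derivative_within_closed_interval[OF zero_less_one assms(3)
      has_vector_derivative_at_within[OF coordinate_line_derivative[OF assms(1,2,4,5)]]] .

lemma velocity_coordinate_line:
  assumes c: "c \<in> A" and t: "t \<in> {0..1}" "x + t *\<^sub>R u \<in> snd c ` fst c"
  shows "velocity A (\<lambda>t. inv_chart c (x + t *\<^sub>R u)) 0 1 t =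
    coord_vector A c (inv_chart c (x + t *\<^sub>R u)) u"
  unfolding velocity_def coord_vector_def coord_inv_chart(1)[OF c t(2)]
  using coordinate_line_vector_derivative[OF c _ t] by (intro ext if_cong) (simp_all add: charts_at_def)

lemma C1_curve_coordinate_line:
  assumes c: "c \<in> A" and line: "\<And>t. t \<in> {0..1} \<Longrightarrow> x + t *\<^sub>R u \<in> snd c ` fst c"
  shows "C1_curve A (\<lambda>t. inv_chart c (x + t *\<^sub>R u)) 0 1"
  unfolding C1_curve_def
proof (intro conjI ballI)
  let ?\<gamma> = "\<lambda>t. inv_chart c (x + t *\<^sub>R u)"
  have "continuous_on (snd c ` fst c) (inv_chart c)"
    using chart_homeomorphism(3)[OF c] by (simp add: homeomorphism_def)
  then show "continuous_on {0..1} ?\<gamma>"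
  proof (rule continuous_on_compose2)
    show "continuous_on {0..1} (\<lambda>t. x + t *\<^sub>R u)" by (intro continuous_intros)
    show "(\<lambda>t. x + t *\<^sub>R u) ` {0..1} \<subseteq> snd c ` fst c" using line by blast
  qed
  fix c' assume c': "c' \<in> A"
  let ?T = "{t \<in> {0..1}. ?\<gamma> t \<in> fst c'}"
  {
    fix t assume "t \<in> ?T"
    then have t: "t \<in> {0..1}" "?\<gamma> t \<in> fst c'" by simp_all
    note has_vector_derivative_at_within[OF coordinate_line_derivative[OF c c' line[OF t(1)] t(2)], of "{0..1}"]
    then show "(snd c' \<circ> ?\<gamma>) differentiable (at t within {0..1})"
      unfolding has_vector_derivative_def by (rule differentiableI)
  }
  have "continuous_on (snd c ` (fst c \<inter> fst c'))
      (\<lambda>y. frechet_derivative (snd c' \<circ> inv_chart c) (at y) u)"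
    using transition_C1[OF c c'] by simp
  then have "continuous_on ?T (\<lambda>t. frechet_derivative (snd c' \<circ> inv_chart c) (at (x + t *\<^sub>R u)) u)"
  proof (rule continuous_on_compose2)
    show "continuous_on ?T (\<lambda>t. x + t *\<^sub>R u)" by (intro continuous_intros)
    show "(\<lambda>t. x + t *\<^sub>R u) ` ?T \<subseteq> snd c ` (fst c \<inter> fst c')"
    proof (rule image_subsetI)
      fix t assume t: "t \<in> ?T"
      then have "x + t *\<^sub>R u = snd c (?\<gamma> t)" "?\<gamma> t \<in> fst c"
        using coord_inv_chart[OF c line[of t]] by simp_all
      with t show "x + t *\<^sub>R u \<in> snd c ` (fst c \<inter> fst c')" by (intro image_eqI[of _ _ "?\<gamma> t"]) simp_all
    qed
  qed
  then show "continuous_on ?T (\<lambda>t. vector_derivative (snd c' \<circ> ?\<gamma>) (at t within {0..1}))"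
  proof (rule continuous_on_eq)
    fix t assume "t \<in> ?T"
    then show "frechet_derivative (snd c' \<circ> inv_chart c) (at (x + t *\<^sub>R u)) u =
        vector_derivative (snd c' \<circ> ?\<gamma>) (at t within {0..1})"
      by (intro coordinate_line_vector_derivative[OF c c' _ line, symmetric]) simp_all
  qed
qed

text \<open>The line is a single piece, so it is a competitor in the infimum with partition \<open>0 < 1\<close>.\<close>
lemma riemannian_dist_le_coordinate_line:
  assumes c: "c \<in> A" and line: "\<And>t. t \<in> {0..1} \<Longrightarrow> x + t *\<^sub>R u \<in> snd c ` fst c"
    and K: "\<And>t. t \<in> {0..1} \<Longrightarrow>
      tangent_norm G (inv_chart c (x + t *\<^sub>R u)) (coord_vector A c (inv_chart c (x + t *\<^sub>R u)) u) \<le> K"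
    and "K \<ge> 0"
  shows "riemannian_dist A G (inv_chart c x) (inv_chart c (x + u)) \<le> ennreal K"
proof -
  let ?\<gamma> = "\<lambda>t. inv_chart c (x + t *\<^sub>R u)"
  have "curve_length A G ?\<gamma> 0 1 \<le> K"
  proof (cases "(\<lambda>t. tangent_norm G (?\<gamma> t) (velocity A ?\<gamma> 0 1 t)) integrable_on {0..1}")
    case True
    have "curve_length A G ?\<gamma> 0 1 \<le> integral {0..1} (\<lambda>t::real. K)"
      unfolding curve_length_def
      by (rule integral_le[OF True]) (auto simp: velocity_coordinate_line[OF c _ line] K)
    then show ?thesis by simp
  next
    \<comment> \<open>The integral of a function that is not integrable is \<open>0\<close>.\<close>
    case False
    then show ?thesis
      using \<open>K \<ge> 0\<close> by (simp add: curve_length_def not_integrable_integral)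
  qed
  then have "ennreal (\<Sum>i<1. curve_length A G ?\<gamma> (real i) (real (Suc i))) \<le> ennreal K"
    by (simp add: ennreal_leI)
  moreover have "riemannian_dist A G (inv_chart c x) (inv_chart c (x + u)) \<le>
      ennreal (\<Sum>i<1. curve_length A G ?\<gamma> (real i) (real (Suc i)))"
    unfolding riemannian_dist_def
  proof (rule Inf_lower, rule CollectI, intro exI conjI)
    show "\<forall>i<1. real i < real (Suc i) \<and> C1_curve A ?\<gamma> (real i) (real (Suc i))"
      using C1_curve_coordinate_line[OF c line] by simp
    show "?\<gamma> (real 0) = inv_chart c x" "?\<gamma> (real 1) = inv_chart c (x + u)" by simp_all
  qed rule
  ultimately show ?thesis by (rule order_trans[rotated])
qed

text \<open>Near \<open>p\<close> the coefficients of the metric are bounded, so for a suitable \<open>C\<close> the segment from \<open>p\<close> to a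
point at coordinate distance \<open>r\<close> has length at most \<open>C * r\<close>.\<close>
lemma riemannian_ball_neighborhood:
  assumes \<epsilon>: "\<epsilon> > 0" and cp: "c \<in> charts_at A p"
  obtains U where "open U" "p \<in> U" "U \<subseteq> riemannian_ball A G \<epsilon> p"
proof -
  have c: "c \<in> A" and p: "p \<in> fst c" using cp by (auto simp: charts_at_def)
  let ?V = "snd c ` fst c" and ?x = "snd c p"
  define H where "H x u w = G (inv_chart c x)
    (coord_vector A c (inv_chart c x) u) (coord_vector A c (inv_chart c x) w)" for x u w
  define N where "N x = (\<Sum>b\<in>Basis. \<Sum>b'\<in>Basis. \<bar>H x b b'\<bar>)" for x
  have "continuous_on ?V N"
    unfolding N_def H_def by (intro continuous_intros continuous_on_metric_in_chart[OF c])
  moreover have V: "open ?V" "?x \<in> ?V" using chart_homeomorphism(2)[OF c] p by auto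
  ultimately have "isCont N ?x" using p by (simp add: continuous_on_eq_continuous_at)
  then have "\<forall>\<^sub>F x in nhds ?x. N x < N ?x + 1"
    by (intro order_tendstoD(2)[of N "N ?x"]) (auto simp: isCont_def tendsto_at_iff_tendsto_nhds)
  moreover have "\<forall>\<^sub>F x in nhds ?x. x \<in> ?V" using V by (auto simp: eventually_nhds)
  ultimately have "\<forall>\<^sub>F x in nhds ?x. x \<in> ?V \<and> N x < N ?x + 1" by (rule eventually_conj[rotated])
  then obtain \<rho> where \<rho>: "\<rho> > 0" "\<And>x. dist x ?x < \<rho> \<Longrightarrow> x \<in> ?V" "\<And>x. dist x ?x < \<rho> \<Longrightarrow> N x < N ?x + 1"
    unfolding eventually_nhds_metric by blast
  define C where "C = sqrt (N ?x + 1)"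
  have "N ?x \<ge> 0" unfolding N_def by (intro sum_nonneg) auto
  then have C: "C > 0" by (simp add: C_def)
  have norm_le: "tangent_norm G (inv_chart c x) (coord_vector A c (inv_chart c x) u) \<le> C * norm u"
    if x: "dist x ?x < \<rho>" for x u
  proof -
    have "c \<in> charts_at A (inv_chart c x)"
      using coord_inv_chart[OF c \<rho>(2)[OF x]] c by (simp add: charts_at_def)
    then have "H x u u \<le> N x * (norm u)\<^sup>2"
      unfolding N_def using metric_in_chart(1) unfolding H_def
      by (intro bilinear_form_le_norm[of "\<lambda>u w. H x u w" for x, unfolded H_def]) auto
    also have "\<dots> \<le> (N ?x + 1) * (norm u)\<^sup>2"
      using \<rho>(3)[OF x] by (intro mult_right_mono) auto
    finally have "sqrt (H x u u) \<le> sqrt ((N ?x + 1) * (norm u)\<^sup>2)" by (rule real_sqrt_le_mono)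
    then show ?thesis by (simp add: H_def tangent_norm_def C_def real_sqrt_mult)
  qed
  define U where "U = fst c \<inter> snd c -` ball ?x (min \<rho> (\<epsilon> / C))"
  show thesis
  proof
    show "open U"
      unfolding U_def using chart_homeomorphism[OF c]
      by (intro continuous_open_preimage) (auto simp: homeomorphism_def)
    show "p \<in> U" using p \<rho>(1) \<epsilon> C by (simp add: U_def)
    show "U \<subseteq> riemannian_ball A G \<epsilon> p"
    proof
      fix q assume q: "q \<in> U"
      define u where "u = snd c q - ?x"
      have u: "norm u < \<rho>" "norm u < \<epsilon> / C"
        using q by (auto simp: U_def u_def dist_norm norm_minus_commute)
      have near: "dist (?x + t *\<^sub>R u) ?x < \<rho>" if "t \<in> {0..1}" for t
      proof -
        have "\<bar>t\<bar> * norm u \<le> 1 * norm u" using that by (intro mult_right_mono) auto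
        then show ?thesis using u(1) by (simp add: dist_norm)
      qed
      have "riemannian_dist A G (inv_chart c ?x) (inv_chart c (?x + u)) \<le> ennreal (C * norm u)"
        using near \<rho>(2) norm_le C by (intro riemannian_dist_le_coordinate_line[OF c]) auto
      moreover have "C * norm u < \<epsilon>" using u(2) C by (simp add: field_simps)
      moreover have "inv_chart c ?x = p" "inv_chart c (?x + u) = q"
        using q p by (auto simp: U_def u_def inv_chart_coord[OF c])
      ultimately show "q \<in> riemannian_ball A G \<epsilon> p"
        using \<epsilon> by (auto simp: riemannian_ball_def intro: le_less_trans ennreal_lessI)
    qed
  qed
qed

end

section \<open>Approximate KKT points under CRSC\<close>

text \<open>The sum type merges the two families of constraints into one: \<open>Inl\<close> marks equalities and \<open>Inr\<close>
inequalities.\<close>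
definition constraint_gradient ::
  "('a, 'e::euclidean_space) chart \<Rightarrow> (nat \<Rightarrow> 'a \<Rightarrow> real) \<Rightarrow> (nat \<Rightarrow> 'a \<Rightarrow> real) \<Rightarrow> 'a \<Rightarrow>
    nat + nat \<Rightarrow> 'e" where
  "constraint_gradient c h g q i = chart_gradient c (case_sum h g i) (snd c q)"

lemma sum_Inl_Inr:
  assumes "finite I" "finite J"
  shows "(\<Sum>i\<in>Inl ` I \<union> Inr ` J. t i) = (\<Sum>i\<in>I. t (Inl i)) + (\<Sum>j\<in>J. t (Inr j))"
  using assms by (subst sum.union_disjoint) (auto simp: sum.reindex)

theorem theorem3p1:
  fixes A :: "('a::{t2_space, second_countable_topology}, real ^ 'n::finite) chart set"
    and G :: "('a, real ^ 'n) metric"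
    and f :: "'a \<Rightarrow> real"
    and s m :: nat
    and h g :: "nat \<Rightarrow> 'a \<Rightarrow> real"
    and p :: 'a
  assumes "complete_riemannian_manifold A G"
    and "C1_manifold A f"
    and "\<And>i. i \<in> {1..s} \<Longrightarrow> C1_manifold A (h i)"
    and "\<And>j. j \<in> {1..m} \<Longrightarrow> C1_manifold A (g j)"
    and "p \<in> feasible_set s m h g"
    and "CRSC A G s m h g p"
    and "AKKT_point A G s m f h g p"
  shows "KKT_point A G s m f h g p"
proof -
  have riem: "riemannian_manifold A G"
    using assms(1) by (simp add: complete_riemannian_manifold_def)
  have "p \<in> (\<Union>c\<in>A. fst c)"
    using riem by (simp add: riemannian_manifold_def smooth_atlas_def)
  then obtain c where cA: "c \<in> A" and cp: "c \<in> charts_at A p"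
    by (auto simp: charts_at_def)
  have C1: "(F \<circ> inv_chart c) differentiable (at (snd c q))"
    "continuous_on (snd c ` fst c) (chart_gradient c F)"
    if F: "C1_manifold A F" and q: "c \<in> charts_at A q" for F q
  proof -
    have "Ck_on 1 (snd c ` fst c) (F \<circ> inv_chart c)"
      using F cA by (simp add: C1_manifold_def del: One_nat_def)
    then show "continuous_on (snd c ` fst c) (chart_gradient c F)"
      and "(F \<circ> inv_chart c) differentiable (at (snd c q))"
      using q continuous_on_chart_gradient by (blast, auto simp: charts_at_def)
  qed
  define Act where "Act = active_set m g p"
  define E where "E = (Inl ` {1..s} :: (nat + nat) set)"
  define F where "F = (Inr ` Act :: (nat + nat) set)"
  define v where "v = constraint_gradient c h g"
  define J where "J = J_minus A G s m h g p"
  have Act: "Act \<subseteq> {1..m}" "finite Act"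
    by (auto simp: Act_def active_set_def)
  have J: "J \<subseteq> Act" by (auto simp: J_def J_minus_def Act_def)
  have fin: "finite E" "finite F" "E \<inter> F = {}" using Act by (auto simp: E_def F_def)
  have sum_EF: "(\<Sum>i\<in>E \<union> F. y i *\<^sub>R w i) =
      (\<Sum>i=1..s. y (Inl i) *\<^sub>R w (Inl i)) + (\<Sum>j\<in>Act. y (Inr j) *\<^sub>R w (Inr j))"
    for y and w :: "nat + nat \<Rightarrow> 'z::real_vector"
    unfolding E_def F_def using Act by (intro sum_Inl_Inr) auto
  have lagr: "chart_gradient c (lagrangian s m f h g lam \<mu>) (snd c q) =
      chart_gradient c f (snd c q) + (\<Sum>i\<in>E \<union> F. case_sum lam \<mu> i *\<^sub>R v q i)"
    if q: "c \<in> charts_at A q" and \<mu>: "\<forall>j\<in>{1..m} - Act. \<mu> j = 0" for lam \<mu> q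
  proof -
    have "(\<Sum>j=1..m. \<mu> j *\<^sub>R chart_gradient c (g j) (snd c q)) =
        (\<Sum>j\<in>Act. \<mu> j *\<^sub>R chart_gradient c (g j) (snd c q))"
      using Act \<mu> by (intro sum.mono_neutral_right) auto
    then show ?thesis
      using C1(1)[OF _ q] assms(2-4)
      by (subst chart_gradient_lagrangian(2)) (simp_all add: sum_EF v_def constraint_gradient_def)
  qed
  have lagr_diff: "(lagrangian s m f h g lam \<mu> \<circ> inv_chart c) differentiable (at (snd c q))"
    if "c \<in> charts_at A q" for lam \<mu> q
    using C1(1)[OF _ that] assms(2-4) by (intro chart_gradient_lagrangian(1)) auto

  have grad_S: "\<exists>S. linear S \<and> inj S \<and> range S \<subseteq> tangent_space A q \<and>
      (\<forall>F. (F \<circ> inv_chart c) differentiable (at (snd c q)) \<longrightarrow>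
         grad A G F q = S (chart_gradient c F (snd c q)))"
    if "c \<in> charts_at A q" for q
    by (rule grad_musical_isomorphism[OF riem that]) blast

  obtain S where S: "linear S" "inj S" "range S \<subseteq> tangent_space A p"
    and grad_p: "\<And>F. (F \<circ> inv_chart c) differentiable (at (snd c p)) \<Longrightarrow>
         grad A G F p = S (chart_gradient c F (snd c p))"
    using grad_S[OF cp] by blast
  have grad_constraint: "i \<in> {1..s} \<Longrightarrow> grad A G (h i) p = S (v p (Inl i))"
    "j \<in> Act \<Longrightarrow> grad A G (g j) p = S (v p (Inr j))" for i j
    using grad_p C1(1)[OF _ cp] assms(3,4) Act(1) by (auto simp: v_def constraint_gradient_def)
  \<comment> \<open>The map \<open>S\<close> carries the polar cone and \<open>\<J>\<^sub>-(p)\<close> to their coordinate versions.\<close>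
  have comb: "(\<Sum>i=1..s. lam i *\<^sub>R grad A G (h i) p) + (\<Sum>j\<in>Act. \<mu> j *\<^sub>R grad A G (g j) p) =
      S (\<Sum>i\<in>E \<union> F. case_sum lam \<mu> i *\<^sub>R v p i)" for lam \<mu>
    by (simp add: sum_EF linear_add[OF S(1)] linear_sum[OF S(1)] linear_scale[OF S(1)] grad_constraint)
  have cone: "polar_linearized_cone A G s m h g p = S ` multiplier_cone E F (v p)"
  proof (intro equalityI subsetI)
    fix w assume "w \<in> polar_linearized_cone A G s m h g p"
    then obtain lam \<mu> where "\<forall>j\<in>Act. \<mu> j \<ge> 0"
      "w = S (\<Sum>i\<in>E \<union> F. case_sum lam \<mu> i *\<^sub>R v p i)"
      unfolding polar_linearized_cone_def Act_def[symmetric] comb by blast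
    moreover from this have "\<forall>j\<in>F. case_sum lam \<mu> j \<ge> 0" by (auto simp: F_def)
    ultimately show "w \<in> S ` multiplier_cone E F (v p)"
      unfolding multiplier_cone_def by blast
  next
    fix w assume "w \<in> S ` multiplier_cone E F (v p)"
    then obtain y where y: "\<forall>j\<in>F. y j \<ge> 0" "w = S (\<Sum>i\<in>E \<union> F. y i *\<^sub>R v p i)"
      unfolding multiplier_cone_def by blast
    have "y = case_sum (y \<circ> Inl) (y \<circ> Inr)" by (simp add: fun_eq_iff split: sum.split)
    then have "w = (\<Sum>i=1..s. (y \<circ> Inl) i *\<^sub>R grad A G (h i) p) + (\<Sum>j\<in>Act. (y \<circ> Inr) j *\<^sub>R grad A G (g j) p)"
      using y(2) comb by metis
    moreover have "\<forall>j\<in>Act. (y \<circ> Inr) j \<ge> 0" using y(1) by (auto simp: F_def)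
    moreover have "w \<in> tangent_space A p" using y(2) S(3) by blast
    ultimately show "w \<in> polar_linearized_cone A G s m h g p"
      unfolding polar_linearized_cone_def Act_def[symmetric] by blast
  qed
  have rev: "reversible_indices E F (v p) = Inr ` J"
  proof -
    have "j \<in> J \<longleftrightarrow> - v p (Inr j) \<in> multiplier_cone E F (v p)" if "j \<in> Act" for j
    proof -
      have "j \<in> J \<longleftrightarrow> - grad A G (g j) p \<in> S ` multiplier_cone E F (v p)"
        using that by (simp add: J_def J_minus_def cone Act_def)
      also have "- grad A G (g j) p = S (- v p (Inr j))"
        using that by (simp add: grad_constraint linear_neg[OF S(1)])
      finally show ?thesis by (simp add: inj_image_mem_iff[OF S(2)])
    qed
    then show ?thesis using J by (auto simp: reversible_indices_def F_def)
  qed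
  \<comment> \<open>At each point the isomorphism is a different one, but each preserves the rank.\<close>
  have rank_q: "dim ({grad A G (h i) q | i. i \<in> {1..s}} \<union> {grad A G (g j) q | j. j \<in> J}) =
      dim (v q ` (E \<union> reversible_indices E F (v p)))" if q: "c \<in> charts_at A q" for q
  proof -
    obtain T where T: "linear T" "inj T"
      and grad_q: "\<And>F. (F \<circ> inv_chart c) differentiable (at (snd c q)) \<Longrightarrow>
         grad A G F q = T (chart_gradient c F (snd c q))"
      using grad_S[OF q] by blast
    have "(\<lambda>i. grad A G (h i) q) ` {1..s} = T ` v q ` Inl ` {1..s}"
      unfolding image_image using grad_q C1(1)[OF _ q] assms(3)
      by (intro image_cong) (auto simp: v_def constraint_gradient_def)
    moreover have "(\<lambda>j. grad A G (g j) q) ` J = T ` v q ` Inr ` J"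
      unfolding image_image using grad_q C1(1)[OF _ q] assms(4) Act(1) J
      by (intro image_cong) (auto simp: v_def constraint_gradient_def)
    ultimately have "{grad A G (h i) q | i. i \<in> {1..s}} \<union> {grad A G (g j) q | j. j \<in> J} =
        T ` v q ` (E \<union> reversible_indices E F (v p))"
      by (simp only: rev) (simp only: E_def image_Un Setcompr_eq_image)
    then show ?thesis by (simp add: dim_injective_linear_image[OF T])
  qed

  obtain P lam \<mu> where \<mu>: "\<And>k j. j \<in> {1..m} \<Longrightarrow> \<mu> k j \<ge> 0" and P: "P \<longlonglongrightarrow> p"
    and stat: "(\<lambda>k. tangent_norm G (P k) (grad A G (lagrangian s m f h g (lam k) (\<mu> k)) (P k)))
      \<longlonglongrightarrow> 0"
    and compl: "\<forall>\<^sub>F k in sequentially. \<forall>j\<in>{1..m} - Act. \<mu> k j = 0"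
    using assms(7) unfolding AKKT_point_def Act_def by blast
  have chart: "\<forall>\<^sub>F k in sequentially. c \<in> charts_at A (P k)"
    by (rule coord_tendsto(1)[OF riem cp P])
  from assms(6) obtain \<epsilon> r where \<epsilon>: "\<epsilon> > 0"
    and r: "\<And>q. q \<in> riemannian_ball A G \<epsilon> p \<Longrightarrow>
      dim ({grad A G (h i) q | i. i \<in> {1..s}} \<union> {grad A G (g j) q | j. j \<in> J}) = r"
    unfolding CRSC_def J_def by blast
  obtain U where U: "open U" "p \<in> U" "U \<subseteq> riemannian_ball A G \<epsilon> p"
    using riemannian_ball_neighborhood[OF riem \<epsilon> cp] .

  have "- chart_gradient c f (snd c p) \<in> multiplier_cone E F (v p)"
  proof (rule constant_rank_limit_multipliers[OF fin, where v = "\<lambda>k. v (P k)"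
        and c = "\<lambda>k. chart_gradient c f (snd c (P k))" and x = "\<lambda>k. case_sum (lam k) (\<mu> k)"])
    show "(\<lambda>k. chart_gradient c f (snd c (P k))) \<longlonglongrightarrow> chart_gradient c f (snd c p)"
      using C1(2)[OF assms(2) cp] by (rule tendsto_in_chart[OF riem cp P])
    show "(\<lambda>k. v (P k) i) \<longlonglongrightarrow> v p i" if "i \<in> E \<union> F" for i
    proof -
      have "C1_manifold A (case_sum h g i)"
        using that assms(3,4) Act(1) by (auto simp: E_def F_def)
      from tendsto_in_chart[OF riem cp P C1(2)[OF this cp]]
      show ?thesis by (simp add: v_def constraint_gradient_def)
    qed
    show "case_sum (lam k) (\<mu> k) j \<ge> 0" if "j \<in> F" for k j
      using that \<mu> Act(1) by (auto simp: F_def)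
    have "(\<lambda>k. chart_gradient c (lagrangian s m f h g (lam k) (\<mu> k)) (snd c (P k))) \<longlonglongrightarrow> 0"
      using eventually_mono[OF chart lagr_diff] by (rule chart_gradient_tendsto_0[OF riem cp P _ stat])
    moreover have "\<forall>\<^sub>F k in sequentially.
        chart_gradient c (lagrangian s m f h g (lam k) (\<mu> k)) (snd c (P k)) =
        chart_gradient c f (snd c (P k)) + (\<Sum>i\<in>E \<union> F. case_sum (lam k) (\<mu> k) i *\<^sub>R v (P k) i)"
      using chart compl by eventually_elim (rule lagr)
    ultimately show "(\<lambda>k. chart_gradient c f (snd c (P k)) +
        (\<Sum>i\<in>E \<union> F. case_sum (lam k) (\<mu> k) i *\<^sub>R v (P k) i)) \<longlonglongrightarrow> 0"
      by (rule Lim_transform_eventually)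
    have "\<forall>\<^sub>F k in sequentially. P k \<in> U" using P U topological_tendstoD by blast
    with chart show "\<forall>\<^sub>F k in sequentially. dim (v (P k) ` (E \<union> reversible_indices E F (v p))) =
        dim (v p ` (E \<union> reversible_indices E F (v p)))"
    proof eventually_elim
      case (elim k)
      then have "P k \<in> riemannian_ball A G \<epsilon> p" "p \<in> riemannian_ball A G \<epsilon> p"
        using U(2,3) by auto
      from r[OF this(1)] r[OF this(2)] rank_q[OF elim(1)] rank_q[OF cp] show ?case by simp
    qed
  qed
  then obtain y where y: "\<forall>j\<in>F. y j \<ge> 0"
    "- chart_gradient c f (snd c p) = (\<Sum>i\<in>E \<union> F. y i *\<^sub>R v p i)"
    unfolding multiplier_cone_def by blast
  define lam' where "lam' i = y (Inl i)" for i
  \<comment> \<open>The multiplier cone says nothing about inactive indices; complementarity demands \<open>0\<close> there.\<close>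
  define \<mu>' where "\<mu>' j = (if j \<in> Act then y (Inr j) else 0)" for j
  have "(\<Sum>i\<in>E \<union> F. case_sum lam' \<mu>' i *\<^sub>R v p i) = (\<Sum>i\<in>E \<union> F. y i *\<^sub>R v p i)"
    by (simp add: sum_EF lam'_def \<mu>'_def)
  then have "chart_gradient c (lagrangian s m f h g lam' \<mu>') (snd c p) = 0"
    using y(2) by (subst lagr[OF cp]) (simp_all add: \<mu>'_def, metis add.right_inverse)
  then have "grad A G (lagrangian s m f h g lam' \<mu>') p = 0"
    using grad_p[OF lagr_diff[OF cp]] S(1) by (simp add: linear_0)
  moreover have "\<forall>j\<in>{1..m}. \<mu>' j \<ge> 0" "\<forall>j\<in>{1..m} - Act. \<mu>' j = 0"
    using y(1) by (auto simp: \<mu>'_def F_def)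
  ultimately show ?thesis
    using assms(5) unfolding KKT_point_def Act_def by blast
qed

end
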